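(* Let $c>5/2$ and let $p_{lk}=n^{-c}$ for all nodes in the Bayesian CART prior. Suppose $f_0$ satisfies Assumption (F)(a) (stated in the context) with the constant $A>0$ (independent of $n$) sufficiently large. Then, with probability at least $1-4/n$, the $\epsilon$-mixing time of the Bayesian CART Markov chain satisfies $$\tau_\epsilon\le 2^{2L+3}\left\{n\left[\left(c+\frac12\right)\log(1+n)+|\mathcal T^*_{int}|\,C_{f_0}^2+1\right]+4\,|\mathcal T^*_{int}|\log n+\log\left(\frac2\epsilon\right)\right\},$$ where $C_{f_0}$ is the constant from Assumption (F).
   Context: Model: $n=2^{L_{\max}+1}$, $x_i=i/n$, and $Y_i=f_0(x_i)+\varepsilon_i$ for $i=1,\dots,n$ with $\varepsilon_i$ i.i.d. $\mathcal N(0,1)$; probability refers to the law of $Y=(Y_1,\dots,Y_n)'$. Haar basis: $\psi_{-10}=I_{[0,1]}$ and $\psi_{lk}(x)=2^{l/2}\psi(2^lx-k)$ for $l\ge 0$, $0\le k<2^l$, with $\psi=I_{(0,1/2]}-I_{(1/2,1]}$. $\bm X$ is the $n\times p$ matrix, $p=2^{L_{\max}}=n/2$, whose columns are $(\psi_{lk}(x_i))_{i\le n}$ for $(l,k)=(-1,0)$ and $0\le l<L_{\max}$, $0\le k<2^l$ (so $\bm X'\bm X=nI_p$). Trees: fix $L\le L_{\max}$. A tree $\mathcal T$ of depth at most $L$ is determined by its set of internal nodes $\mathcal T_{int}$, consisting of $(-1,0)$ together with a (possibly empty) set of nodes $(l,k)$, $0\le l<L$, $0\le k<2^l$, that contains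 with each $(l,k)$, $l\ge1$, its parent $(l-1,\lfloor k/2\rfloor)$. The children of $(l,k)$ ($l\ge 0$) are $(l+1,2k),(l+1,2k+1)$; the only child of $(-1,0)$ is $(0,0)$. The external nodes $\mathcal T_{ext}$ are the nodes not in $\mathcal T_{int}$ that are children of nodes in $\mathcal T_{int}$. $\mathbb T_L$ is the set of all such trees; $\mathcal T_{null}$ has internal node set $\{(-1,0)\}$; $\mathcal T^L_{full}$ has all nodes with $l<L$ internal. $\mathcal P(\mathcal T)$ is the set of pre-terminal nodes: $(l,k)\in\mathcal T_{int}$, $l\ge0$, with both children in $\mathcal T_{ext}$. Bayesian CART prior and posterior: $\Pi(\mathcal T)\propto\prod_{(l,k)\in\mathcal T_{int}}p_{lk}\prod_{(l,k)\in\mathcal T_{ext}}(1-p_{lk})$ on $\mathbb T_L$; given $\mathcal T$, the coefficients $\beta_{lk}$, $(l,k)\in\mathcal T_{int}$, are i.i.d. $\mathcal N(0,1)$ and all others are $0$; the likelihood is $Y\mid\beta\sim\mathcal N(\bm X\beta,I_n)$. Equivalently $\Pi(\mathcal T\mid Y)\propto\Pi(\mathcal T)N_Y(\mathcal T)$ with $N_Y(\mathcal T)=(2\pi)^{-n/2}(1+n)^{-|\mathcal T_{ext}|/2}\exp\{-\frac12Y'[I-\bm X_{\mathcal T}\Sigma_{\mathcal T}\bm X_{\mathcal T}']Y\}$, $\Sigma_{\mathcal T}=\frac n{n+1}(\bm X_{\mathcal T}'\bm X_{\mathcal T})^{-1}$, $\bm X_{\mathcal T}$ being the columns of $\bm X$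 indexed by $\mathcal T_{int}$. Assumption (F): $f_0=\sum_{(l,k)\in\mathcal B}\beta^*_{lk}\psi_{lk}$ for some $\mathcal B\subseteq\{(l,k):l<L\}$ with $A\log n/\sqrt n<|\beta^*_{lk}|<C_{f_0}$ for all $(l,k)\in\mathcal B$, for constants $A>0$, $C_{f_0}>0$. $\mathcal T^*\in\mathbb T_L$ denotes the smallest tree with $\mathcal B\subseteq\mathcal T^*_{int}$. (a): $\mathcal B$ is itself the internal node set of a tree, i.e. $\mathcal T^*_{int}=\mathcal B$. Bayesian CART chain (Metropolis--Hastings on $\mathbb T_L$): the proposal is $S(\mathcal T\to\widetilde{\mathcal T})=\gamma(\mathcal T)S_{GROW}(\mathcal T\to\widetilde{\mathcal T})+(1-\gamma(\mathcal T))S_{PRUNE}(\mathcal T\to\widetilde{\mathcal T})$ with $\gamma(\mathcal T)=1/2$ for $\mathcal T\notin\{\mathcal T_{null},\mathcal T^L_{full}\}$, $\gamma(\mathcal T_{null})=1$, $\gamma(\mathcal T^L_{full})=0$. GROW picks uniformly $(l,k)\in\mathcal T_{ext}$ and makes it internal, $S_{GROW}=1/|\mathcal T_{ext}|$ (a proposal outside $\mathbb T_L$ has zero posterior probability and is rejected); PRUNE picks uniformly $(l,k)\in\mathcal P(\mathcal T)$ and makes it external, $S_{PRUNE}=1/|\mathcal P(\mathcal T)|$. A proposal is accepted with probability $\alpha(\mathcal T,\widetilde{\mathcal T})=\min\{1,\frac{\Pi(\widetilde{\mathcal T}\mid Y)S(\widetilde{\mathcal T}\to\mathcal T)}{\Pi(\mathcal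 T\mid Y)S(\mathcal T\to\widetilde{\mathcal T})}\}$; otherwise the chain stays. With $\widetilde P$ the resulting transition matrix, the chain analysed is the lazy chain $P=\widetilde P/2+I/2$. Mixing time: $\tau_\epsilon=\max_{\mathcal T\in\mathbb T_L}\min\{t\in\mathbb N:\|P^{t'}(\mathcal T,\cdot)-\Pi(\cdot\mid Y)\|_{TV}\le\epsilon\text{ for all }t'\ge t\}$, $\epsilon\in(0,1)$. *)

theory Defs
  imports "HOL-Probability.Probability"
begin

subsection \<open>Haar basis and regression model\<close>

type_synonym node = "int \<times> nat"

definition mother :: "real \<Rightarrow> real" where
  "mother x = indicator {0<..1/2} x - indicator {1/2<..1} x"

fun haar :: "node \<Rightarrow> real \<Rightarrow> real" where
  "haar (l, k) x =
     (if l = -1 then indicator {0..1} x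
      else 2 powr (real_of_int l / 2) * mother (2 ^ nat l * x - real k))"

definition grid :: "nat \<Rightarrow> nat \<Rightarrow> real" where
  "grid n i = real i / real n"

definition design :: "nat \<Rightarrow> nat \<Rightarrow> node \<Rightarrow> real" where
  "design n i v = haar v (grid n i)"

abbreviation std_normal :: "real measure" where
  "std_normal \<equiv> density lborel std_normal_density"

definition data_law :: "nat \<Rightarrow> (real \<Rightarrow> real) \<Rightarrow> (nat \<Rightarrow> real) measure" where
  "data_law n f0 =
     distr (\<Pi>\<^sub>M i\<in>{1..n}. std_normal) (\<Pi>\<^sub>M i\<in>{1..n}. borel)
       (\<lambda>e. \<lambda>i\<in>{1..n}. f0 (grid n i) + e i)"


subsection \<open>Trees, identified with their sets of internal nodes\<close>

definition nodes :: "nat \<Rightarrow> node set" where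
  "nodes L = insert (-1, 0) {(l, k). 0 \<le> l \<and> l < int L \<and> k < 2 ^ nat l}"

definition cart_trees :: "nat \<Rightarrow> node set set" where
  "cart_trees L = {T. (-1, 0) \<in> T \<and> T \<subseteq> nodes L \<and>
                 (\<forall>(l, k)\<in>T. l \<ge> 1 \<longrightarrow> (l - 1, k div 2) \<in> T)}"

definition null_tree :: "node set" where
  "null_tree = {(-1, 0)}"

definition full_tree :: "nat \<Rightarrow> node set" where
  "full_tree L = nodes L"

fun children :: "node \<Rightarrow> node set" where
  "children (l, k) = (if l = -1 then {(0, 0)} else {(l + 1, 2 * k), (l + 1, 2 * k + 1)})"

definition ext_nodes :: "node set \<Rightarrow> node set" where
  "ext_nodes T = (\<Union>v\<in>T. children v) - T"

definition preterminal :: "node set \<Rightarrow> node set" where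
  "preterminal T = {v \<in> T. fst v \<ge> 0 \<and> children v \<subseteq> ext_nodes T}"

text \<open>Here \<open>LEAST\<close> is with respect to inclusion.\<close>

definition smallest_tree :: "nat \<Rightarrow> node set \<Rightarrow> node set" where
  "smallest_tree L B = (LEAST T. T \<in> cart_trees L \<and> B \<subseteq> T)"

definition assumption_F ::
  "real \<Rightarrow> real \<Rightarrow> nat \<Rightarrow> nat \<Rightarrow> (real \<Rightarrow> real) \<Rightarrow> node set \<Rightarrow> (node \<Rightarrow> real) \<Rightarrow> bool" where
  "assumption_F A C n L f0 B \<beta> \<longleftrightarrow>
     B \<subseteq> nodes L \<and>
     (\<forall>x\<in>{0..1}. f0 x = (\<Sum>v\<in>B. \<beta> v * haar v x)) \<and>
     (\<forall>v\<in>B. A * ln (real n) / sqrt (real n) < \<bar>\<beta> v\<bar> \<and> \<bar>\<beta> v\<bar> < C)"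


subsection \<open>Prior and posterior on trees\<close>

definition prior_weight :: "(node \<Rightarrow> real) \<Rightarrow> node set \<Rightarrow> real" where
  "prior_weight p T = (\<Prod>v\<in>T. p v) * (\<Prod>v\<in>ext_nodes T. 1 - p v)"

definition prior :: "(node \<Rightarrow> real) \<Rightarrow> nat \<Rightarrow> node set \<Rightarrow> real" where
  "prior p L T =
     (if T \<in> cart_trees L then prior_weight p T / (\<Sum>T'\<in>cart_trees L. prior_weight p T') else 0)"

text \<open>Gaussian likelihood of \<open>Y\<close> when the coefficients outside \<open>T\<close> vanish, and its average
  over independent standard normal coefficients on \<open>T\<close>. As the design columns are orthogonal, with
  squared length \<open>n\<close>, and \<open>T\<close> has as many external as internal nodes, this integral is the closed form
  \<open>(2\<pi>)^(-n/2) (1+n)^(-|ext T|/2) exp (-1/2 Y'(I - X\<^sub>T \<Sigma>\<^sub>T X\<^sub>T')Y)\<close>, where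
  \<open>\<Sigma>\<^sub>T = n/(n+1) (X\<^sub>T'X\<^sub>T)^(-1)\<close>.\<close>

definition likelihood :: "nat \<Rightarrow> node set \<Rightarrow> (node \<Rightarrow> real) \<Rightarrow> (nat \<Rightarrow> real) \<Rightarrow> real" where
  "likelihood n T \<beta> Y = (\<Prod>i\<in>{1..n}. normal_density (\<Sum>v\<in>T. design n i v * \<beta> v) 1 (Y i))"

definition marginal_likelihood :: "nat \<Rightarrow> (nat \<Rightarrow> real) \<Rightarrow> node set \<Rightarrow> real" where
  "marginal_likelihood n Y T = (\<integral>\<beta>. likelihood n T \<beta> Y \<partial>(\<Pi>\<^sub>M v\<in>T. std_normal))"

definition posterior ::
  "nat \<Rightarrow> (node \<Rightarrow> real) \<Rightarrow> nat \<Rightarrow> (nat \<Rightarrow> real) \<Rightarrow> node set \<Rightarrow> real" where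
  "posterior n p L Y T =
     prior p L T * marginal_likelihood n Y T
       / (\<Sum>T'\<in>cart_trees L. prior p L T' * marginal_likelihood n Y T')"


subsection \<open>The Metropolis--Hastings chain\<close>

text \<open>For \<open>L = 0\<close> the null and full trees coincide and are the only tree, so that the order of the
  cases below is immaterial for the chain.\<close>

definition grow_prob :: "nat \<Rightarrow> node set \<Rightarrow> real" where
  "grow_prob L T = (if T = null_tree then 1 else if T = full_tree L then 0 else 1/2)"

definition S_grow :: "node set \<Rightarrow> node set \<Rightarrow> real" where
  "S_grow T T' = (if \<exists>v\<in>ext_nodes T. T' = insert v T then 1 / real (card (ext_nodes T)) else 0)"

definition S_prune :: "node set \<Rightarrow> node set \<Rightarrow> real" where
  "S_prune T T' =
     (if \<exists>v\<in>preterminal T. T' = T - {v} then 1 / real (card (preterminal T)) else 0)"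

definition proposal :: "nat \<Rightarrow> node set \<Rightarrow> node set \<Rightarrow> real" where
  "proposal L T T' = grow_prob L T * S_grow T T' + (1 - grow_prob L T) * S_prune T T'"

definition acceptance ::
  "nat \<Rightarrow> (node \<Rightarrow> real) \<Rightarrow> nat \<Rightarrow> (nat \<Rightarrow> real) \<Rightarrow> node set \<Rightarrow> node set \<Rightarrow> real" where
  "acceptance n p L Y T T' =
     min 1 (posterior n p L Y T' * proposal L T' T / (posterior n p L Y T * proposal L T T'))"

text \<open>The diagonal collects all rejected proposals, including those that leave \<open>cart_trees L\<close>.\<close>

definition mh_kernel ::
  "nat \<Rightarrow> (node \<Rightarrow> real) \<Rightarrow> nat \<Rightarrow> (nat \<Rightarrow> real) \<Rightarrow> node set \<Rightarrow> node set \<Rightarrow> real" where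
  "mh_kernel n p L Y T T' =
     (if T' = T
      then 1 - (\<Sum>U\<in>cart_trees L - {T}. proposal L T U * acceptance n p L Y T U)
      else proposal L T T' * acceptance n p L Y T T')"

definition cart_kernel ::
  "nat \<Rightarrow> (node \<Rightarrow> real) \<Rightarrow> nat \<Rightarrow> (nat \<Rightarrow> real) \<Rightarrow> node set \<Rightarrow> node set \<Rightarrow> real" where
  "cart_kernel n p L Y T T' = mh_kernel n p L Y T T' / 2 + (if T' = T then 1 else 0) / 2"


subsection \<open>Mixing time\<close>

primrec kernel_power ::
  "'s set \<Rightarrow> ('s \<Rightarrow> 's \<Rightarrow> real) \<Rightarrow> nat \<Rightarrow> 's \<Rightarrow> 's \<Rightarrow> real" where
  "kernel_power \<Omega> P 0 x y = (if x = y then 1 else 0)"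
| "kernel_power \<Omega> P (Suc t) x y = (\<Sum>z\<in>\<Omega>. P x z * kernel_power \<Omega> P t z y)"

definition tv_dist :: "'s set \<Rightarrow> ('s \<Rightarrow> real) \<Rightarrow> ('s \<Rightarrow> real) \<Rightarrow> real" where
  "tv_dist \<Omega> \<mu> \<nu> = (MAX E\<in>Pow \<Omega>. \<bar>sum \<mu> E - sum \<nu> E\<bar>)"

text \<open>Values in \<open>enat\<close>: a chain that never gets \<open>\<epsilon>\<close>-close has mixing time \<open>\<infinity>\<close>.\<close>

definition mixing_time ::
  "'s set \<Rightarrow> ('s \<Rightarrow> 's \<Rightarrow> real) \<Rightarrow> ('s \<Rightarrow> real) \<Rightarrow> real \<Rightarrow> enat" where
  "mixing_time \<Omega> P \<pi> \<epsilon> =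
     (MAX x\<in>\<Omega>. INF t\<in>{t. \<forall>t'\<ge>t. tv_dist \<Omega> (kernel_power \<Omega> P t' x) \<pi> \<le> \<epsilon>}. enat t)"

definition cart_mixing_time ::
  "nat \<Rightarrow> (node \<Rightarrow> real) \<Rightarrow> nat \<Rightarrow> (nat \<Rightarrow> real) \<Rightarrow> real \<Rightarrow> enat" where
  "cart_mixing_time n p L Y \<epsilon> =
     mixing_time (cart_trees L) (cart_kernel n p L Y) (posterior n p L Y) \<epsilon>"

end

theory Submission
  imports Defs
begin

text \<open>
  Since the design columns are orthogonal and a tree has as many external as internal nodes, the
  posterior weight of a tree is a product of node weights
  \<open>w v = p (1 - p) (1 + n)^(-1/2) exp (s\<^sub>v\<^sup>2 / (2 (1 + n)))\<close>, where \<open>s\<^sub>v\<close> is the inner product of the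
  data with column \<open>v\<close> (\<open>posterior_eq\<close>). Thus \<open>s\<^sub>v\<close> is \<open>n \<beta>\<^sub>v\<close> on the signal tree \<open>B\<close> and \<open>0\<close> elsewhere,
  plus Gaussian noise of variance \<open>n\<close>. By a Chernoff bound all noise terms are below
  \<open>2 sqrt (n ln n)\<close> with probability at least \<open>1 - 1/n\<close> (\<open>small_noise_prob\<close>), and then \<open>w v \<le> 1/n\<close> off
  \<open>B\<close>, because \<open>c > 5/2\<close>, and \<open>w v \<ge> n\<close> on \<open>B\<close>, because the signal is strong.

  In this situation the posterior is concentrated around \<open>B\<close>. From any tree walk to \<open>B\<close> by pruning a
  deepest node outside \<open>B\<close> as long as there is one, and then by growing the missing nodes of \<open>B\<close>, shallowest first.
  Every step multiplies the mass by at least \<open>n\<close>, so that all trees whose walk visits a tree \<open>y\<close> have total mass at most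
  \<open>2 \<mu> y\<close> (\<open>mass_via_le\<close>). A walk has at most \<open>2 ^ L\<close> steps, and a proposal along it has probability at least
  \<open>2 ^ -(L + 1)\<close>. Comparing \<open>f x - f B\<close> with the increments of \<open>f\<close> along the walk gives a
  Poincare inequality (\<open>poincare_by_descent\<close>) and hence a spectral gap of at least \<open>2 ^ -(2 L + 3)\<close> for
  the lazy chain.

  A lazy reversible chain with gap \<open>g\<close> contracts mean-zero functions in \<open>L\<^sup>2\<close> by the factor \<open>1 - g\<close>, so that its
  distance from equilibrium, when started in \<open>x\<close>, is at most \<open>(1 - g)^t / (2 sqrt (\<mu> x))\<close>. As \<open>\<mu> B \<ge> 1/2\<close>, the
  smallest posterior mass is bounded below by comparing node weights with those of \<open>B\<close>
  (\<open>measure_ge\<close>), which yields the first two terms in the braces of the bound.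
\<close>

section \<open>Finite reversible chains\<close>

locale reversible_chain =
  fixes \<Omega> :: "'s set" and P :: "'s \<Rightarrow> 's \<Rightarrow> real" and \<pi> :: "'s \<Rightarrow> real"
  assumes finite_states: "finite \<Omega>"
    and stationary_pos: "x \<in> \<Omega> \<Longrightarrow> 0 < \<pi> x"
    and stationary_sum: "sum \<pi> \<Omega> = 1"
    and kernel_nonneg: "x \<in> \<Omega> \<Longrightarrow> y \<in> \<Omega> \<Longrightarrow> 0 \<le> P x y"
    and kernel_sum: "x \<in> \<Omega> \<Longrightarrow> (\<Sum>y\<in>\<Omega>. P x y) = 1"
    and balance: "x \<in> \<Omega> \<Longrightarrow> y \<in> \<Omega> \<Longrightarrow> \<pi> x * P x y = \<pi> y * P y x"
begin

definition mean :: "('s \<Rightarrow> real) \<Rightarrow> real" where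
  "mean f = (\<Sum>x\<in>\<Omega>. \<pi> x * f x)"

definition step :: "('s \<Rightarrow> real) \<Rightarrow> 's \<Rightarrow> real" where
  "step f x = (\<Sum>y\<in>\<Omega>. P x y * f y)"

definition form :: "('s \<Rightarrow> real) \<Rightarrow> ('s \<Rightarrow> real) \<Rightarrow> real" where
  "form f g = (\<Sum>x\<in>\<Omega>. \<Sum>y\<in>\<Omega>. \<pi> x * P x y * (f x * g y))"

definition dirichlet :: "('s \<Rightarrow> real) \<Rightarrow> real" where
  "dirichlet f = (\<Sum>x\<in>\<Omega>. \<Sum>y\<in>\<Omega>. \<pi> x * P x y * (f x - f y)\<^sup>2) / 2"

lemma sum_row: "x \<in> \<Omega> \<Longrightarrow> (\<Sum>y\<in>\<Omega>. \<pi> x * P x y * a) = \<pi> x * a"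
  using kernel_sum[of x] by (simp add: sum_distrib_left[symmetric] sum_distrib_right[symmetric])

lemma sum_square_first: "(\<Sum>x\<in>\<Omega>. \<Sum>y\<in>\<Omega>. \<pi> x * P x y * h x) = mean h"
  unfolding mean_def by (intro sum.cong refl sum_row)

lemma sum_square_second: "(\<Sum>x\<in>\<Omega>. \<Sum>y\<in>\<Omega>. \<pi> x * P x y * h y) = mean h"
proof -
  have "(\<Sum>x\<in>\<Omega>. \<Sum>y\<in>\<Omega>. \<pi> x * P x y * h y) = (\<Sum>y\<in>\<Omega>. \<Sum>x\<in>\<Omega>. \<pi> x * P x y * h y)"
    by (rule sum.swap)
  also have "\<dots> = (\<Sum>y\<in>\<Omega>. \<Sum>x\<in>\<Omega>. \<pi> y * P y x * h y)"
    by (intro sum.cong refl) (simp add: balance)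
  finally show ?thesis using sum_square_first by simp
qed

lemma form_sym: "form f g = form g f"
proof -
  have "form f g = (\<Sum>y\<in>\<Omega>. \<Sum>x\<in>\<Omega>. \<pi> x * P x y * (f x * g y))"
    unfolding form_def by (rule sum.swap)
  also have "\<dots> = (\<Sum>y\<in>\<Omega>. \<Sum>x\<in>\<Omega>. \<pi> y * P y x * (g y * f x))"
    by (intro sum.cong refl) (simp add: balance mult.commute)
  finally show ?thesis unfolding form_def .
qed

lemma form_step: "form f g = mean (\<lambda>x. f x * step g x)"
  unfolding form_def mean_def step_def
  by (simp add: sum_distrib_left algebra_simps)

text \<open>Stationarity of \<open>\<pi>\<close>, in functional form.\<close>

lemma mean_step: "mean (step f) = mean f"
proof -
  have "mean (step f) = form (\<lambda>_. 1) f" by (simp add: form_step)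
  also have "\<dots> = mean f" unfolding form_def using sum_square_second[of f] by simp
  finally show ?thesis .
qed

lemma form_diff_scaled:
  "form (\<lambda>x. f x - a * g x) (\<lambda>x. f x - a * g x) = form f f - 2 * a * form f g + a\<^sup>2 * form g g"
proof -
  have "form (\<lambda>x. f x - a * g x) (\<lambda>x. f x - a * g x)
      = form f f - a * form f g - a * form g f + a\<^sup>2 * form g g"
    unfolding form_def
    by (simp add: sum_distrib_left sum_subtractf[symmetric] sum.distrib[symmetric]
        power2_eq_square algebra_simps)
  then show ?thesis using form_sym[of g f] by simp
qed

lemma form_eq_dirichlet: "form f f = mean (\<lambda>x. (f x)\<^sup>2) - dirichlet f"
proof -
  have "2 * dirichlet f = (\<Sum>x\<in>\<Omega>. \<Sum>y\<in>\<Omega>. \<pi> x * P x y * (f x)\<^sup>2)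
      + (\<Sum>x\<in>\<Omega>. \<Sum>y\<in>\<Omega>. \<pi> x * P x y * (f y)\<^sup>2) - 2 * form f f"
    unfolding dirichlet_def form_def
    by (simp add: sum_distrib_left sum_subtractf[symmetric] sum.distrib[symmetric]
        power2_eq_square algebra_simps)
  then show ?thesis by (simp add: sum_square_first sum_square_second)
qed

lemma form_ge: "- mean (\<lambda>x. (f x)\<^sup>2) \<le> form f f"
proof -
  have "0 \<le> (\<Sum>x\<in>\<Omega>. \<Sum>y\<in>\<Omega>. \<pi> x * P x y * (f x + f y)\<^sup>2)"
    by (intro sum_nonneg mult_nonneg_nonneg kernel_nonneg less_imp_le[OF stationary_pos]) auto
  also have "\<dots> = (\<Sum>x\<in>\<Omega>. \<Sum>y\<in>\<Omega>. \<pi> x * P x y * (f x)\<^sup>2)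
      + (\<Sum>x\<in>\<Omega>. \<Sum>y\<in>\<Omega>. \<pi> x * P x y * (f y)\<^sup>2) + 2 * form f f"
    unfolding form_def
    by (simp add: sum_distrib_left sum.distrib[symmetric]
        power2_eq_square algebra_simps)
  finally show ?thesis by (simp add: sum_square_first sum_square_second)
qed

lemma mean_square_centred:
  "mean (\<lambda>x. (f x - mean f)\<^sup>2) = mean (\<lambda>x. (f x - a)\<^sup>2) - (mean f - a)\<^sup>2"
proof -
  have *: "mean (\<lambda>x. (f x - b)\<^sup>2) = mean (\<lambda>x. (f x)\<^sup>2) - 2 * b * mean f + b\<^sup>2" for b
  proof -
    have "mean (\<lambda>x. (f x - b)\<^sup>2) = mean (\<lambda>x. (f x)\<^sup>2) - 2 * b * mean f + b\<^sup>2 * sum \<pi> \<Omega>"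
      unfolding mean_def
      by (simp add: sum_distrib_left sum_subtractf[symmetric] sum.distrib[symmetric]
          power2_eq_square algebra_simps)
    then show ?thesis by (simp add: stationary_sum)
  qed
  show ?thesis unfolding *[of "mean f"] *[of a] by (simp add: power2_eq_square algebra_simps)
qed

text \<open>The mean minimises the mean square deviation, so that in a Poincare inequality the mean may be
  replaced by the value of the function at a chosen state.\<close>

lemma variance_le: "mean (\<lambda>x. (f x - mean f)\<^sup>2) \<le> mean (\<lambda>x. (f x - a)\<^sup>2)"
  by (simp add: mean_square_centred[of f a])

end

text \<open>For a chain whose transition operator is nonnegative, the bound on the quadratic form below means that
  the spectrum on mean-zero functions lies in the interval from \<open>0\<close> to \<open>r\<close>.\<close>

locale contracting_chain = reversible_chain +
  fixes r :: real
  assumes rate_pos: "0 < r"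
    and form_nonneg: "0 \<le> form f f"
    and form_contract: "mean f = 0 \<Longrightarrow> form f f \<le> r * mean (\<lambda>x. (f x)\<^sup>2)"
begin

text \<open>Write \<open>g = P f\<close>. Then \<open>\<langle>g, f\<rangle>\<^sub>P = |g|\<^sup>2\<close>, and expanding \<open>0 \<le> \<langle>g - r f, g - r f\<rangle>\<^sub>P\<close> with the bound \<open>r\<close> on both
  diagonal terms leaves \<open>r |g|\<^sup>2 \<le> r\<^sup>3 |f|\<^sup>2\<close>. This replaces the spectral theorem and loses no constant.\<close>

lemma step_contract:
  assumes "mean f = 0"
  shows "mean (\<lambda>x. (step f x)\<^sup>2) \<le> r\<^sup>2 * mean (\<lambda>x. (f x)\<^sup>2)"
proof -
  let ?g = "step f"
  have fg: "form ?g f = mean (\<lambda>x. (?g x)\<^sup>2)"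
    by (simp add: form_step power2_eq_square)
  have "0 \<le> form (\<lambda>x. ?g x - r * f x) (\<lambda>x. ?g x - r * f x)" by (rule form_nonneg)
  also have "\<dots> = form ?g ?g - 2 * r * mean (\<lambda>x. (?g x)\<^sup>2) + r\<^sup>2 * form f f"
    by (simp add: form_diff_scaled fg)
  also have "\<dots> \<le> r * mean (\<lambda>x. (?g x)\<^sup>2) - 2 * r * mean (\<lambda>x. (?g x)\<^sup>2)
      + r\<^sup>2 * (r * mean (\<lambda>x. (f x)\<^sup>2))"
    using form_contract[of ?g] form_contract[of f] assms
    by (intro add_mono diff_mono mult_left_mono) (auto simp: mean_step less_imp_le[OF rate_pos])
  finally have "r * mean (\<lambda>x. (?g x)\<^sup>2) \<le> r * (r\<^sup>2 * mean (\<lambda>x. (f x)\<^sup>2))"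
    by (simp add: mult.left_commute)
  then show ?thesis using rate_pos by (simp only: mult_le_cancel_left_pos)
qed

text \<open>The deviation, as a function of the initial state, is \<open>P^t\<close> applied to the centred
  indicator of \<open>E\<close>. That function has variance at most \<open>1/4\<close>, and a point value is at most the norm divided
  by \<open>sqrt (\<pi> x)\<close>.\<close>

lemma kernel_power_deviation:
  assumes E: "E \<subseteq> \<Omega>" and x: "x \<in> \<Omega>"
  shows "\<bar>sum (kernel_power \<Omega> P t x) E - sum \<pi> E\<bar> \<le> r ^ t / (2 * sqrt (\<pi> x))"
proof -
  define u where "u t x = sum (kernel_power \<Omega> P t x) E - sum \<pi> E" for t x
  have finE: "finite E" using E finite_states finite_subset by blast
  have u0: "u 0 x = (if x \<in> E then 1 else 0) - sum \<pi> E" for x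
    unfolding u_def using finE by simp
  have uS: "u (Suc t) x = step (u t) x" if "x \<in> \<Omega>" for t x
  proof -
    have "sum (kernel_power \<Omega> P (Suc t) x) E = (\<Sum>z\<in>\<Omega>. P x z * sum (kernel_power \<Omega> P t z) E)"
      by (simp add: sum_distrib_left) (rule sum.swap)
    moreover have "(\<Sum>z\<in>\<Omega>. P x z * sum \<pi> E) = sum \<pi> E"
      using kernel_sum[OF that] by (simp add: sum_distrib_right[symmetric])
    ultimately show ?thesis
      unfolding u_def step_def by (simp add: right_diff_distrib sum_subtractf)
  qed
  have mean_cong: "mean f = mean g" if "\<And>x. x \<in> \<Omega> \<Longrightarrow> f x = g x" for f g
    unfolding mean_def using that by simp
  have ind: "(\<Sum>x\<in>\<Omega>. \<pi> x * (if x \<in> E then 1 else 0)) = sum \<pi> E"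
    using E finite_states by (simp add: sum.inter_restrict[symmetric] Int_absorb1 if_distrib cong: if_cong)
  have main: "mean (u t) = 0 \<and> mean (\<lambda>x. (u t x)\<^sup>2) \<le> (r ^ t)\<^sup>2 / 4"
  proof (induction t)
    case 0
    have m: "mean (u 0) = 0"
      unfolding mean_def u0
      by (simp add: right_diff_distrib sum_subtractf ind sum_distrib_right[symmetric] stationary_sum)
    let ?q = "sum \<pi> E"
    have "mean (\<lambda>x. (u 0 x)\<^sup>2) = (\<Sum>x\<in>\<Omega>. \<pi> x * (if x \<in> E then 1 else 0) * (1 - 2 * ?q) + \<pi> x * ?q\<^sup>2)"
      unfolding mean_def u0 by (intro sum.cong refl) (auto simp: power2_eq_square algebra_simps)
    also have "\<dots> = ?q - ?q\<^sup>2"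
      by (simp add: sum.distrib sum_distrib_right[symmetric] ind stationary_sum)
        (simp add: power2_eq_square algebra_simps)
    also have "\<dots> \<le> 1 / 4"
      using zero_le_power2[of "?q - 1/2"] by (simp add: power2_eq_square algebra_simps)
    finally show ?case using m by simp
  next
    case (Suc t)
    have "mean (u (Suc t)) = 0" using mean_cong[of "u (Suc t)" "step (u t)"] uS Suc by (simp add: mean_step)
    moreover have "mean (\<lambda>x. (u (Suc t) x)\<^sup>2) \<le> r\<^sup>2 * mean (\<lambda>x. (u t x)\<^sup>2)"
      using mean_cong[of "\<lambda>x. (u (Suc t) x)\<^sup>2" "\<lambda>x. (step (u t) x)\<^sup>2"] uS step_contract[of "u t"] Suc
      by simp
    moreover have "r\<^sup>2 * mean (\<lambda>x. (u t x)\<^sup>2) \<le> r\<^sup>2 * ((r ^ t)\<^sup>2 / 4)"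
      using Suc by (intro mult_left_mono) auto
    ultimately show ?case by (simp add: power_mult_distrib)
  qed
  have "\<pi> x * (u t x)\<^sup>2 \<le> mean (\<lambda>x. (u t x)\<^sup>2)"
    unfolding mean_def using x finite_states
    by (intro member_le_sum) (auto intro!: mult_nonneg_nonneg less_imp_le[OF stationary_pos])
  with main have "\<pi> x * (u t x)\<^sup>2 \<le> (r ^ t)\<^sup>2 / 4" by simp
  then have "sqrt (\<pi> x * (u t x)\<^sup>2) \<le> sqrt ((r ^ t)\<^sup>2 / 4)" by (rule real_sqrt_le_mono)
  then have "sqrt (\<pi> x) * \<bar>u t x\<bar> \<le> r ^ t / 2"
    using rate_pos by (simp add: real_sqrt_mult real_sqrt_divide power_abs)
  then show ?thesis
    using stationary_pos[OF x] unfolding u_def by (simp add: field_simps)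
qed

end

definition lazy :: "('s \<Rightarrow> 's \<Rightarrow> real) \<Rightarrow> 's \<Rightarrow> 's \<Rightarrow> real" where
  "lazy P x y = P x y / 2 + (if y = x then 1 else 0) / 2"

lemma (in reversible_chain) lazy_reversible: "reversible_chain \<Omega> (lazy P) \<pi>"
proof
  show "(\<Sum>y\<in>\<Omega>. lazy P x y) = 1" if "x \<in> \<Omega>" for x
    using that finite_states kernel_sum[OF that]
    by (simp add: lazy_def sum.distrib sum_divide_distrib[symmetric])
qed (auto simp: finite_states stationary_pos stationary_sum lazy_def kernel_nonneg field_simps balance)

text \<open>Holding with probability \<open>1/2\<close> makes the transition operator nonnegative and halves the
  Dirichlet form, which explains the factor \<open>2\<close> in the assumed gap.\<close>

lemma (in reversible_chain) lazy_contracting: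
  assumes g: "0 < g" "g < 1"
    and gap: "\<And>f. mean f = 0 \<Longrightarrow> 2 * g * mean (\<lambda>x. (f x)\<^sup>2) \<le> dirichlet f"
  shows "contracting_chain \<Omega> (lazy P) \<pi> (1 - g)"
proof -
  interpret lazy: reversible_chain \<Omega> "lazy P" \<pi> by (rule lazy_reversible)
  have lazy_form: "lazy.form f f = (form f f + mean (\<lambda>x. (f x)\<^sup>2)) / 2" for f
  proof -
    have "lazy.form f f = (\<Sum>x\<in>\<Omega>. \<Sum>y\<in>\<Omega>. \<pi> x * P x y * (f x * f y) / 2
        + (if y = x then \<pi> x * (f x)\<^sup>2 / 2 else 0))"
      unfolding lazy.form_def
      by (intro sum.cong refl) (auto simp: lazy_def power2_eq_square field_simps)
    also have "\<dots> = (form f f + mean (\<lambda>x. (f x)\<^sup>2)) / 2"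
      unfolding form_def mean_def using finite_states
      by (simp add: sum.distrib sum_divide_distrib[symmetric] add_divide_distrib)
    finally show ?thesis .
  qed
  show ?thesis
  proof
    show "0 < 1 - g" using g by simp
    show "0 \<le> lazy.form f f" for f using form_ge[of f] by (simp add: lazy_form)
    show "lazy.form f f \<le> (1 - g) * lazy.mean (\<lambda>x. (f x)\<^sup>2)" if "lazy.mean f = 0" for f
    proof -
      have "2 * g * mean (\<lambda>x. (f x)\<^sup>2) \<le> dirichlet f" using that by (rule gap)
      then show ?thesis unfolding lazy_form form_eq_dirichlet by (simp add: algebra_simps diff_divide_distrib)
    qed
  qed
qed

section \<open>Poincare inequality by descent to a mode\<close>

lemma square_sum_le_card:
  fixes h :: "'a \<Rightarrow> real"
  assumes "finite A"
  shows "(\<Sum>x\<in>A. h x)\<^sup>2 \<le> real (card A) * (\<Sum>x\<in>A. (h x)\<^sup>2)"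
  using Cauchy_Schwarz_ineq_sum[of "\<lambda>_. 1" h A] by (simp add: mult.commute)

text \<open>Iterating \<open>g\<close> leads from every state to \<open>b\<close> in at most \<open>m\<close> steps, and \<open>R x y\<close> holds at least when \<open>y\<close> is visited on
  the way from \<open>x\<close>. By Cauchy--Schwarz \<open>(f x - f b)\<^sup>2\<close> is at most \<open>m\<close> times the sum of the squared increments at
  the visited states. Averaging over \<open>x\<close> charges the increment at \<open>y\<close> with the mass of all states routed
  through \<open>y\<close>, which is at most \<open>a \<pi> y\<close>, while its share of the Dirichlet form is at least \<open>q \<pi> y\<close>.\<close>

lemma (in reversible_chain) poincare_by_descent:
  fixes d :: "'s \<Rightarrow> nat"
  assumes b: "b \<in> \<Omega>"
    and down: "\<And>x. x \<in> \<Omega> \<Longrightarrow> x \<noteq> b \<Longrightarrow> g x \<in> \<Omega>"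
    and descend: "\<And>x. x \<in> \<Omega> \<Longrightarrow> x \<noteq> b \<Longrightarrow> d x = Suc (d (g x))"
    and via_refl: "\<And>x. x \<in> \<Omega> \<Longrightarrow> R x x"
    and via_down: "\<And>x y. x \<in> \<Omega> \<Longrightarrow> y \<in> \<Omega> \<Longrightarrow> x \<noteq> b \<Longrightarrow> R (g x) y \<Longrightarrow> R x y"
    and d_bound: "\<And>x. x \<in> \<Omega> \<Longrightarrow> d x \<le> m"
    and mass: "\<And>y. y \<in> \<Omega> \<Longrightarrow> (\<Sum>x | x \<in> \<Omega> \<and> R x y. \<pi> x) \<le> a * \<pi> y"
    and flow: "\<And>y. y \<in> \<Omega> \<Longrightarrow> y \<noteq> b \<Longrightarrow> q \<le> P y (g y)"
    and q: "0 \<le> q" and a: "0 \<le> a"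
  shows "q * mean (\<lambda>x. (f x - f b)\<^sup>2) \<le> real m * a * dirichlet f"
proof -
  define h where "h y = f y - f (g y)" for y
  have path: "\<exists>A. A \<subseteq> {y \<in> \<Omega>. y \<noteq> b \<and> R x y} \<and> card A \<le> d x \<and> f x - f b = sum h A
      \<and> (\<forall>y\<in>A. d y \<le> d x)"
    if "x \<in> \<Omega>" "d x = k" for x k
    using that
  proof (induction k arbitrary: x)
    case 0
    then have "x = b" using descend by force
    then show ?case by (intro exI[of _ "{}"]) auto
  next
    case (Suc k)
    show ?case
    proof (cases "x = b")
      case True
      then show ?thesis by (intro exI[of _ "{}"]) auto
    next
      case False
      with Suc.prems have gx: "g x \<in> \<Omega>" "d (g x) = k" using down descend by force+
      from Suc.IH[OF this] obtain A where
        A: "A \<subseteq> {y \<in> \<Omega>. y \<noteq> b \<and> R (g x) y}" "card A \<le> d (g x)" "f (g x) - f b = sum h A"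
          "\<forall>y\<in>A. d y \<le> d (g x)" by blast
      have "finite A" using A(1) finite_states by (auto intro: finite_subset)
      moreover have "x \<notin> A" using A(4) gx(2) Suc.prems by auto
      ultimately show ?thesis
        using A False Suc.prems gx via_refl via_down
        by (intro exI[of _ "insert x A"]) (auto simp: h_def)
    qed
  qed
  have sq: "(f x - f b)\<^sup>2 \<le> real m * (\<Sum>y | y \<in> \<Omega> - {b} \<and> R x y. (h y)\<^sup>2)" if x: "x \<in> \<Omega>" for x
  proof -
    obtain A where A: "A \<subseteq> {y \<in> \<Omega>. y \<noteq> b \<and> R x y}" "card A \<le> d x" "f x - f b = sum h A"
      using path[OF x refl] by blast
    have fin: "finite A" using A(1) finite_states by (auto intro: finite_subset)
    have "(f x - f b)\<^sup>2 \<le> real (card A) * (\<Sum>y\<in>A. (h y)\<^sup>2)"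
      unfolding A(3) using fin by (rule square_sum_le_card)
    also have "\<dots> \<le> real m * (\<Sum>y | y \<in> \<Omega> - {b} \<and> R x y. (h y)\<^sup>2)"
      using A(1,2) d_bound[OF x] finite_states
      by (intro mult_mono sum_mono2 sum_nonneg) auto
    finally show ?thesis .
  qed
  have "mean (\<lambda>x. (f x - f b)\<^sup>2)
      \<le> (\<Sum>x\<in>\<Omega>. \<pi> x * (real m * (\<Sum>y | y \<in> \<Omega> - {b} \<and> R x y. (h y)\<^sup>2)))"
    unfolding mean_def by (intro sum_mono mult_left_mono sq less_imp_le[OF stationary_pos]) auto
  also have "\<dots> = real m * (\<Sum>x\<in>\<Omega>. \<Sum>y | y \<in> \<Omega> - {b} \<and> R x y. \<pi> x * (h y)\<^sup>2)"
    by (simp add: sum_distrib_left algebra_simps)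
  also have "(\<Sum>x\<in>\<Omega>. \<Sum>y | y \<in> \<Omega> - {b} \<and> R x y. \<pi> x * (h y)\<^sup>2)
      = (\<Sum>y\<in>\<Omega> - {b}. \<Sum>x | x \<in> \<Omega> \<and> R x y. \<pi> x * (h y)\<^sup>2)"
    using finite_states by (intro sum.swap_restrict) auto
  also have "\<dots> \<le> (\<Sum>y\<in>\<Omega> - {b}. a * \<pi> y * (h y)\<^sup>2)"
    by (intro sum_mono) (auto simp: sum_distrib_right[symmetric] intro!: mult_right_mono mass)
  finally have 1: "mean (\<lambda>x. (f x - f b)\<^sup>2) \<le> real m * (\<Sum>y\<in>\<Omega> - {b}. a * \<pi> y * (h y)\<^sup>2)"
    by (simp add: mult_left_mono)
  \<comment> \<open>Each edge from \<open>y\<close> to \<open>g y\<close> enters the Dirichlet form in both directions, which cancels its factor \<open>1/2\<close>.\<close>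
  define F where "F = (\<lambda>(x, y). \<pi> x * P x y * (f x - f y)\<^sup>2)"
  have F_nonneg: "0 \<le> F e" if "e \<in> \<Omega> \<times> \<Omega>" for e
    using that unfolding F_def
    by (auto intro!: mult_nonneg_nonneg less_imp_le[OF stationary_pos] kernel_nonneg)
  have F_swap: "F (y, x) = F (x, y)" if "x \<in> \<Omega>" "y \<in> \<Omega>" for x y
    using balance[OF that] unfolding F_def by (simp add: power2_commute)
  let ?up = "(\<lambda>y. (y, g y)) ` (\<Omega> - {b})" and ?dn = "(\<lambda>y. (g y, y)) ` (\<Omega> - {b})"
  have disj: "?up \<inter> ?dn = {}"
  proof -
    have False if "y \<in> \<Omega> - {b}" "z \<in> \<Omega> - {b}" "y = g z" "g y = z" for y z
      using descend[of y] descend[of z] that by simp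
    then show ?thesis by auto
  qed
  have "(\<Sum>y\<in>\<Omega> - {b}. F (y, g y)) + (\<Sum>y\<in>\<Omega> - {b}. F (g y, y)) = sum F ?up + sum F ?dn"
    by (simp add: sum.reindex inj_on_def)
  also have "\<dots> = sum F (?up \<union> ?dn)"
    using disj finite_states by (intro sum.union_disjoint[symmetric]) auto
  also have "\<dots> \<le> sum F (\<Omega> \<times> \<Omega>)"
    using finite_states down F_nonneg by (intro sum_mono2) auto
  also have "\<dots> = 2 * dirichlet f"
    unfolding dirichlet_def F_def by (simp add: sum.cartesian_product)
  also have "(\<Sum>y\<in>\<Omega> - {b}. F (g y, y)) = (\<Sum>y\<in>\<Omega> - {b}. F (y, g y))"
    using down by (intro sum.cong refl F_swap) auto
  finally have "(\<Sum>y\<in>\<Omega> - {b}. F (y, g y)) \<le> dirichlet f" by simp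
  moreover have "(\<Sum>y\<in>\<Omega> - {b}. q * (\<pi> y * (h y)\<^sup>2)) \<le> (\<Sum>y\<in>\<Omega> - {b}. F (y, g y))"
  proof (intro sum_mono)
    fix y assume y: "y \<in> \<Omega> - {b}"
    then have "q * (\<pi> y * (h y)\<^sup>2) \<le> P y (g y) * (\<pi> y * (h y)\<^sup>2)"
      using flow by (intro mult_right_mono mult_nonneg_nonneg less_imp_le[OF stationary_pos]) auto
    then show "q * (\<pi> y * (h y)\<^sup>2) \<le> F (y, g y)" by (simp add: F_def h_def mult_ac)
  qed
  ultimately have 2: "q * (\<Sum>y\<in>\<Omega> - {b}. \<pi> y * (h y)\<^sup>2) \<le> dirichlet f"
    by (simp add: sum_distrib_left)
  have "q * mean (\<lambda>x. (f x - f b)\<^sup>2) \<le> q * (real m * (\<Sum>y\<in>\<Omega> - {b}. a * \<pi> y * (h y)\<^sup>2))"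
    using 1 q by (rule mult_left_mono)
  also have "\<dots> = real m * a * (q * (\<Sum>y\<in>\<Omega> - {b}. \<pi> y * (h y)\<^sup>2))"
    by (simp add: sum_distrib_left mult_ac)
  also have "\<dots> \<le> real m * a * dirichlet f"
    using 2 a by (intro mult_left_mono) auto
  finally show ?thesis .
qed

section \<open>The Metropolis-Hastings kernel\<close>

definition metropolis :: "'s set \<Rightarrow> ('s \<Rightarrow> real) \<Rightarrow> ('s \<Rightarrow> 's \<Rightarrow> real) \<Rightarrow> 's \<Rightarrow> 's \<Rightarrow> real" where
  "metropolis \<Omega> \<pi> S x y =
     (if y = x then 1 - (\<Sum>u\<in>\<Omega> - {x}. S x u * min 1 (\<pi> u * S u x / (\<pi> x * S x u)))
      else S x y * min 1 (\<pi> y * S y x / (\<pi> x * S x y)))"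

text \<open>The accepted flow is symmetric in the two states; detailed balance is immediate from this form. If only one of
  the two proposals is possible, both sides vanish.\<close>

lemma metropolis_flow:
  assumes "0 < \<pi> x" "0 < \<pi> y" "0 \<le> S x y" "0 \<le> S y x" "x \<noteq> y"
  shows "\<pi> x * metropolis \<Omega> \<pi> S x y = min (\<pi> x * S x y) (\<pi> y * S y x)"
proof (cases "S x y = 0")
  case True
  then show ?thesis using assms by (simp add: metropolis_def)
next
  case False
  then have "0 < \<pi> x * S x y" using assms by simp
  moreover have "r * min 1 (s / r) = min r s" if "0 < r" for r s :: real
    using that by (cases "s \<le> r") (simp_all add: min_def)
  ultimately have "(\<pi> x * S x y) * min 1 (\<pi> y * S y x / (\<pi> x * S x y))
      = min (\<pi> x * S x y) (\<pi> y * S y x)"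
    by blast
  then show ?thesis using assms by (simp add: metropolis_def mult.assoc)
qed

lemma metropolis_reversible:
  assumes fin: "finite \<Omega>" and pos: "\<And>x. x \<in> \<Omega> \<Longrightarrow> 0 < \<pi> x" and total: "sum \<pi> \<Omega> = 1"
    and S: "\<And>x y. x \<in> \<Omega> \<Longrightarrow> y \<in> \<Omega> \<Longrightarrow> 0 \<le> S x y"
    and S_sum: "\<And>x. x \<in> \<Omega> \<Longrightarrow> (\<Sum>y\<in>\<Omega> - {x}. S x y) \<le> 1"
  shows "reversible_chain \<Omega> (metropolis \<Omega> \<pi> S) \<pi>"
proof
  show "0 \<le> metropolis \<Omega> \<pi> S x y" if "x \<in> \<Omega>" "y \<in> \<Omega>" for x y
  proof (cases "y = x")
    case True
    have "(\<Sum>u\<in>\<Omega> - {x}. S x u * min 1 (\<pi> u * S u x / (\<pi> x * S x u))) \<le> (\<Sum>u\<in>\<Omega> - {x}. S x u * 1)"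
      using that S by (intro sum_mono mult_left_mono) auto
    with S_sum[OF that(1)] True show ?thesis by (simp add: metropolis_def)
  next
    case False
    have "0 \<le> \<pi> y * S y x / (\<pi> x * S x y)"
      using that S[of x y] S[of y x] pos[of x] pos[of y] by simp
    with False that S show ?thesis by (simp add: metropolis_def)
  qed
  show "(\<Sum>y\<in>\<Omega>. metropolis \<Omega> \<pi> S x y) = 1" if "x \<in> \<Omega>" for x
  proof -
    have "(\<Sum>y\<in>\<Omega>. metropolis \<Omega> \<pi> S x y)
        = metropolis \<Omega> \<pi> S x x + (\<Sum>y\<in>\<Omega> - {x}. metropolis \<Omega> \<pi> S x y)"
      using fin that by (rule sum.remove)
    also have "(\<Sum>y\<in>\<Omega> - {x}. metropolis \<Omega> \<pi> S x y)
        = (\<Sum>y\<in>\<Omega> - {x}. S x y * min 1 (\<pi> y * S y x / (\<pi> x * S x y)))"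
      by (intro sum.cong refl) (auto simp: metropolis_def)
    finally show ?thesis by (simp add: metropolis_def)
  qed
  show "\<pi> x * metropolis \<Omega> \<pi> S x y = \<pi> y * metropolis \<Omega> \<pi> S y x" if "x \<in> \<Omega>" "y \<in> \<Omega>" for x y
    using metropolis_flow[of \<pi> x y S \<Omega>] metropolis_flow[of \<pi> y x S \<Omega>] that pos S
    by (cases "x = y") (auto simp: min.commute)
qed (use assms in auto)

section \<open>Trees\<close>

lemma node_cases:
  assumes "v \<in> nodes L"
  obtains "v = (-1, 0)" | l k where "v = (int l, k)" "l < L" "k < 2 ^ l"
proof -
  obtain a k where v: "v = (a, k)" by (cases v)
  show thesis
  proof (cases "v = (-1, 0)")
    case False
    with assms v that(2)[of "nat a" k] show thesis by (auto simp: nodes_def)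
  qed (rule that(1))
qed

lemma nodes_eq: "nodes L = insert (-1, 0) (\<Union>l<L. (\<lambda>k. (int l, k)) ` {..<2 ^ l})"
proof -
  have "(a, k) \<in> (\<Union>l<L. (\<lambda>k. (int l, k)) ` {..<2 ^ l})"
    if "0 \<le> a" "a < int L" "k < 2 ^ nat a" for a k
    using that by (intro UN_I[of "nat a"]) auto
  then show ?thesis by (auto simp: nodes_def)
qed

lemma finite_nodes [simp]: "finite (nodes L)"
  by (simp add: nodes_eq)

lemma card_nodes: "card (nodes L) = 2 ^ L"
proof (induction L)
  case 0
  show ?case by (simp add: nodes_eq)
next
  case (Suc L)
  have "nodes (Suc L) = nodes L \<union> (\<lambda>k. (int L, k)) ` {..<2 ^ L}"
    by (auto simp: nodes_eq lessThan_Suc)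
  moreover have "nodes L \<inter> (\<lambda>k. (int L, k)) ` {..<2 ^ L} = {}"
    by (auto simp: nodes_def)
  ultimately show ?case
    using Suc by (simp add: card_Un_disjoint card_image inj_on_def)
qed

lemma root_in_nodes [simp]: "(-1, 0) \<in> nodes L"
  by (simp add: nodes_def)

lemma nodes_mono: "L \<le> M \<Longrightarrow> nodes L \<subseteq> nodes M"
  by (auto simp: nodes_def)

text \<open>At the root the value is \<open>(-2, 0)\<close>, which is not a node.\<close>

definition parent :: "node \<Rightarrow> node" where
  "parent v = (if fst v = 0 then (-1, 0) else (fst v - 1, snd v div 2))"

lemma cart_trees_iff:
  "T \<in> cart_trees L \<longleftrightarrow>
     (-1, 0) \<in> T \<and> T \<subseteq> nodes L \<and> (\<forall>v\<in>T. v \<noteq> (-1, 0) \<longrightarrow> parent v \<in> T)"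
proof -
  have "(case v of (l, k) \<Rightarrow> l \<ge> 1 \<longrightarrow> (l - 1, k div 2) \<in> T) \<longleftrightarrow> (v \<noteq> (-1, 0) \<longrightarrow> parent v \<in> T)"
    if "(-1, 0) \<in> T" "v \<in> nodes L" for v
    using that(2)
  proof (cases rule: node_cases)
    case (2 l k)
    then show ?thesis using that(1) by (cases "l = 0") (simp_all add: parent_def)
  qed simp
  then show ?thesis
    unfolding cart_trees_def mem_Collect_eq by (intro conj_cong refl ball_cong) auto
qed

text \<open>The condition on \<open>snd w\<close> excludes the pairs \<open>(0, k)\<close> with \<open>k > 0\<close>, which have the root as parent but are not nodes.\<close>

lemma children_iff:
  assumes "v \<in> nodes L"
  shows "w \<in> children v \<longleftrightarrow> 0 \<le> fst w \<and> (fst w = 0 \<longrightarrow> snd w = 0) \<and> parent w = v"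
  using assms
proof (cases rule: node_cases)
  case 1
  then show ?thesis by (cases w) (auto simp: parent_def)
next
  case (2 l k)
  obtain a b where w: "w = (a, b)" by (cases w)
  have "b div 2 = k \<longleftrightarrow> b = 2 * k \<or> b = 2 * k + 1" by linarith
  then show ?thesis using 2 w by (auto simp: parent_def)
qed

lemma node_fst: "v \<in> nodes L \<Longrightarrow> v \<noteq> (-1, 0) \<Longrightarrow> 0 \<le> fst v \<and> (fst v = 0 \<longrightarrow> snd v = 0)"
  by (auto simp: nodes_def)

lemma finite_cart_trees [simp]: "finite (cart_trees L)"
  by (rule finite_subset[of _ "Pow (nodes L)"]) (auto simp: cart_trees_iff)

lemma tree_finite: "T \<in> cart_trees L \<Longrightarrow> finite T"
  using finite_subset[OF _ finite_nodes] by (auto simp: cart_trees_iff)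

lemma tree_subset: "T \<in> cart_trees L \<Longrightarrow> T \<subseteq> nodes L"
  by (simp add: cart_trees_iff)

lemma tree_root: "T \<in> cart_trees L \<Longrightarrow> (-1, 0) \<in> T"
  by (simp add: cart_trees_iff)

lemma tree_parent: "T \<in> cart_trees L \<Longrightarrow> v \<in> T \<Longrightarrow> v \<noteq> (-1, 0) \<Longrightarrow> parent v \<in> T"
  by (simp add: cart_trees_iff)

lemma card_tree_le: "T \<in> cart_trees L \<Longrightarrow> card T \<le> 2 ^ L"
  using card_mono[OF finite_nodes tree_subset] by (simp add: card_nodes)

lemma finite_children [simp]: "finite (children v)"
  by (cases v) auto

lemma card_children: "v \<in> nodes L \<Longrightarrow> card (children v) = (if v = (-1, 0) then 1 else 2)"
  by (cases rule: node_cases) auto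

lemma finite_ext_nodes: "T \<in> cart_trees L \<Longrightarrow> finite (ext_nodes T)"
  using tree_finite[of T L] by (simp add: ext_nodes_def)

lemma ext_nodes_iff:
  assumes "T \<in> cart_trees L"
  shows "w \<in> ext_nodes T \<longleftrightarrow> w \<notin> T \<and> 0 \<le> fst w \<and> (fst w = 0 \<longrightarrow> snd w = 0) \<and> parent w \<in> T"
proof -
  have "(\<exists>v\<in>T. w \<in> children v)
      \<longleftrightarrow> (\<exists>v\<in>T. 0 \<le> fst w \<and> (fst w = 0 \<longrightarrow> snd w = 0) \<and> parent w = v)"
    using tree_subset[OF assms] by (intro bex_cong refl children_iff) auto
  then show ?thesis by (auto simp: ext_nodes_def)
qed

text \<open>Every internal node except the root has two children and the root has one, which makes \<open>2 |T| - 1\<close>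
  children; all but \<open>|T| - 1\<close> of them are external.\<close>

lemma card_ext_nodes:
  assumes T: "T \<in> cart_trees L"
  shows "card (ext_nodes T) = card T"
proof -
  have sub: "T \<subseteq> nodes L" and fin: "finite T" and root: "(-1, 0) \<in> T"
    using tree_subset[OF T] tree_finite[OF T] tree_root[OF T] by auto
  have disj: "children v \<inter> children w = {}" if "v \<in> T" "w \<in> T" "v \<noteq> w" for v w
  proof -
    have vw: "v \<in> nodes L" "w \<in> nodes L" using that sub by blast+
    have "x \<notin> children w" if "x \<in> children v" for x
      using that children_iff[OF vw(1), of x] children_iff[OF vw(2), of x] \<open>v \<noteq> w\<close> by simp
    then show ?thesis by blast
  qed
  have "card (\<Union>v\<in>T. children v) = (\<Sum>v\<in>T. card (children v))"
    using fin disj by (intro card_UN_disjoint) auto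
  also have "\<dots> = (\<Sum>v\<in>T. if v = (-1, 0) then 1 else 2)"
    using sub card_children by (intro sum.cong refl) blast
  also have "\<dots> = 1 + (\<Sum>v\<in>T - {(-1, 0)}. 2)"
    using fin root by (subst sum.remove[of _ "(-1, 0)"]) auto
  finally have all: "card (\<Union>v\<in>T. children v) = 1 + 2 * card (T - {(-1, 0)})" by simp
  have inner: "T \<inter> (\<Union>v\<in>T. children v) = T - {(-1, 0)}"
  proof (intro equalityI subsetI)
    fix w assume w: "w \<in> T - {(-1, 0)}"
    then have p: "parent w \<in> T" using tree_parent[OF T] by simp
    then have "parent w \<in> nodes L" "w \<in> nodes L" using sub w by blast+
    then have "w \<in> children (parent w)"
      using children_iff[of "parent w" L w] node_fst[of w L] w by simp
    then show "w \<in> T \<inter> (\<Union>v\<in>T. children v)" using p w by blast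
  next
    fix w assume w: "w \<in> T \<inter> (\<Union>v\<in>T. children v)"
    then obtain v where "v \<in> T" "w \<in> children v" by blast
    moreover from this have "v \<in> nodes L" using sub by blast
    ultimately have "0 \<le> fst w" using children_iff[of v L w] by simp
    then show "w \<in> T - {(-1, 0)}" using w by auto
  qed
  have "card (ext_nodes T) = card (\<Union>v\<in>T. children v) - card ((\<Union>v\<in>T. children v) \<inter> T)"
    unfolding ext_nodes_def using fin by (intro card_Diff_subset_Int) auto
  also have "\<dots> = 1 + card (T - {(-1, 0)})"
    using all inner by (simp add: Int_commute)
  also have "\<dots> = card T" using card_Suc_Diff1[OF fin root] by simp
  finally show ?thesis .
qed

lemma smallest_tree_eq: "B \<in> cart_trees L \<Longrightarrow> smallest_tree L B = B"
  unfolding smallest_tree_def by (rule Least_equality) auto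

lemma null_tree_in [simp]: "null_tree \<in> cart_trees L"
  by (auto simp: null_tree_def cart_trees_iff)

text \<open>A deepest node of \<open>T\<close> outside \<open>B\<close> works: a child of it in \<open>T\<close> would be deeper, and it would be
  outside \<open>B\<close> too, since \<open>B\<close> is closed under parents.\<close>

lemma prune_step:
  assumes T: "T \<in> cart_trees L" and B: "B \<in> cart_trees L" and ne: "\<not> T \<subseteq> B"
  shows "\<exists>v\<in>T - B. v \<in> preterminal T \<and> T - {v} \<in> cart_trees L"
proof -
  have fin: "finite (T - B)" "T - B \<noteq> {}" using tree_finite[OF T] ne by auto
  then have "Max (fst ` (T - B)) \<in> fst ` (T - B)" by (intro Max_in) auto
  then obtain v where "v \<in> T - B" "fst v = Max (fst ` (T - B))" by (metis imageE)
  moreover from this fin have "\<forall>w\<in>T - B. fst w \<le> fst v" by simp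
  ultimately have v: "v \<in> T - B" "\<forall>w\<in>T - B. fst w \<le> fst v" by blast+
  have v0: "v \<noteq> (-1, 0)" using v tree_root[OF B] by auto
  have vn: "v \<in> nodes L" using v tree_subset[OF T] by blast
  have fst_child: "fst w = fst v + 1" if "0 \<le> fst w" "parent w = v" for w
    using that v0 by (auto simp: parent_def split: if_splits)
  have nochild: "w \<notin> T" if "0 \<le> fst w" "parent w = v" for w
  proof
    assume "w \<in> T"
    moreover have "w \<noteq> (-1, 0)" using that by auto
    ultimately have "w \<notin> B" using tree_parent[OF B, of w] v that by auto
    with v \<open>w \<in> T\<close> have "fst w \<le> fst v" by auto
    with fst_child[OF that] show False by simp
  qed
  have "v \<in> preterminal T"
    unfolding preterminal_def ext_nodes_def
    using v nochild node_fst[OF vn v0] children_iff[OF vn] by auto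
  moreover have "T - {v} \<in> cart_trees L"
    unfolding cart_trees_iff
  proof (intro conjI ballI impI)
    show "(-1, 0) \<in> T - {v}" "T - {v} \<subseteq> nodes L"
      using v0 tree_root[OF T] tree_subset[OF T] by auto
    fix w assume w: "w \<in> T - {v}" "w \<noteq> (-1, 0)"
    then have "w \<in> nodes L" using tree_subset[OF T] by blast
    with w nochild[of w] node_fst[of w L] tree_parent[OF T, of w]
    show "parent w \<in> T - {v}" by auto
  qed
  ultimately show ?thesis using v by blast
qed

text \<open>A shallowest node of \<open>B\<close> missing in \<open>T\<close> works: its parent is in \<open>B\<close> and shallower, hence in \<open>T\<close>.\<close>

lemma grow_step:
  assumes T: "T \<in> cart_trees L" and B: "B \<in> cart_trees L" and ne: "\<not> B \<subseteq> T"
  shows "\<exists>v\<in>B - T. v \<in> ext_nodes T \<and> insert v T \<in> cart_trees L"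
proof -
  have fin: "finite (B - T)" "B - T \<noteq> {}" using tree_finite[OF B] ne by auto
  then have "Min (fst ` (B - T)) \<in> fst ` (B - T)" by (intro Min_in) auto
  then obtain v where "v \<in> B - T" "fst v = Min (fst ` (B - T))" by (metis imageE)
  moreover from this fin have "\<forall>w\<in>B - T. fst v \<le> fst w" by simp
  ultimately have v: "v \<in> B - T" "\<forall>w\<in>B - T. fst v \<le> fst w" by blast+
  have v0: "v \<noteq> (-1, 0)" using v tree_root[OF T] by auto
  have vn: "v \<in> nodes L" using v tree_subset[OF B] by blast
  have "parent v \<in> B" using tree_parent[OF B _ v0] v by blast
  moreover have "fst (parent v) < fst v" using node_fst[OF vn v0] by (auto simp: parent_def)
  ultimately have p: "parent v \<in> T" using v by force
  have "v \<in> ext_nodes T" using ext_nodes_iff[OF T] v p node_fst[OF vn v0] by blast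
  moreover have "insert v T \<in> cart_trees L"
    using T vn p by (auto simp: cart_trees_iff)
  ultimately show ?thesis using v by blast
qed

text \<open>The two lemmas below show that growing and pruning undo each other, so that a move and its
  reverse are both proposed.\<close>

lemma preterminal_insert:
  assumes T: "T \<in> cart_trees L" and v: "v \<in> ext_nodes T" and T': "insert v T \<in> cart_trees L"
  shows "v \<in> preterminal (insert v T)"
proof -
  have vn: "v \<in> nodes L" using tree_subset[OF T'] by blast
  have v1: "v \<notin> T" "0 \<le> fst v" using ext_nodes_iff[OF T] v by auto
  have "w \<notin> insert v T" if w: "w \<in> children v" for w
  proof
    assume "w \<in> insert v T"
    moreover have "parent w = v" "0 \<le> fst w" using w children_iff[OF vn] by auto
    moreover have "v \<noteq> (-1, 0)" "w \<noteq> (-1, 0)" using v1 calculation by auto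
    moreover have "parent v \<noteq> v" using v1 \<open>v \<noteq> (-1, 0)\<close> by (auto simp: parent_def prod_eq_iff)
    ultimately show False using tree_parent[OF T, of w] v1 by auto
  qed
  then show ?thesis
    using v1 by (auto simp: preterminal_def ext_nodes_def)
qed

lemma ext_nodes_remove:
  assumes T: "T \<in> cart_trees L" and v: "v \<in> preterminal T" and T': "T - {v} \<in> cart_trees L"
  shows "v \<in> ext_nodes (T - {v})"
proof -
  have v1: "v \<in> T" "v \<noteq> (-1, 0)" using v tree_root[OF T'] by (auto simp: preterminal_def)
  have vn: "v \<in> nodes L" using v1 tree_subset[OF T] by blast
  have "parent v \<noteq> v" using node_fst[OF vn v1(2)] by (auto simp: parent_def prod_eq_iff)
  then show ?thesis
    using ext_nodes_iff[OF T'] node_fst[OF vn v1(2)] tree_parent[OF T v1] by blast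
qed

section \<open>The proposal distribution\<close>

lemma preterminal_subset: "preterminal T \<subseteq> T"
  by (auto simp: preterminal_def)

lemma finite_preterminal: "T \<in> cart_trees L \<Longrightarrow> finite (preterminal T)"
  by (rule finite_subset[OF preterminal_subset tree_finite])

lemma S_grow_nonneg: "0 \<le> S_grow T T'" and S_prune_nonneg: "0 \<le> S_prune T T'"
  by (simp_all add: S_grow_def S_prune_def)

lemma grow_prob_bounds: "0 \<le> grow_prob L T" "grow_prob L T \<le> 1"
  by (auto simp: grow_prob_def)

lemma proposal_nonneg: "0 \<le> proposal L T T'"
  using S_grow_nonneg S_prune_nonneg grow_prob_bounds[of L T]
  by (auto simp: proposal_def)

text \<open>An inequality, since a move may lead outside \<open>\<Omega>\<close> and distinct choices may lead to the same state.\<close>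

lemma sum_uniform_move_le:
  assumes "finite \<Omega>" "finite V"
  shows "(\<Sum>U\<in>\<Omega>. if \<exists>v\<in>V. U = m v then 1 / real (card V) else 0) \<le> 1"
proof -
  have "(\<Sum>U\<in>\<Omega>. if \<exists>v\<in>V. U = m v then 1 / real (card V) else 0)
      = (\<Sum>U\<in>{U\<in>\<Omega>. \<exists>v\<in>V. U = m v}. 1 / real (card V))"
    using assms by (simp add: sum.If_cases Int_def)
  also have "\<dots> \<le> (\<Sum>U\<in>m ` V. 1 / real (card V))"
    using assms by (intro sum_mono2) auto
  also have "\<dots> \<le> real (card V) * (1 / real (card V))"
    using card_image_le[OF assms(2), of m] by (simp add: divide_right_mono)
  also have "\<dots> \<le> 1" by simp
  finally show ?thesis .
qed

lemma proposal_sum_le: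
  assumes "T \<in> cart_trees L" "finite \<Omega>"
  shows "(\<Sum>U\<in>\<Omega>. proposal L T U) \<le> 1"
proof -
  have "(\<Sum>U\<in>\<Omega>. proposal L T U)
      = grow_prob L T * sum (S_grow T) \<Omega> + (1 - grow_prob L T) * sum (S_prune T) \<Omega>"
    by (simp add: proposal_def sum.distrib sum_distrib_left)
  also have "\<dots> \<le> grow_prob L T * 1 + (1 - grow_prob L T) * 1"
    using assms grow_prob_bounds[of L T] unfolding S_grow_def S_prune_def
    by (intro add_mono mult_left_mono sum_uniform_move_le finite_ext_nodes finite_preterminal) auto
  finally show ?thesis by simp
qed

text \<open>The number of choices is at most \<open>2 ^ L\<close>, and the direction of the move is chosen with probability at least
  \<open>1/2\<close>: a tree that can grow within depth \<open>L\<close> is not full, and a tree with a pre-terminal node is not null.\<close>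

lemma proposal_grow_ge:
  assumes T: "T \<in> cart_trees L" and v: "v \<in> ext_nodes T" and T': "insert v T \<in> cart_trees L"
  shows "1 / 2 ^ (L + 1) \<le> proposal L T (insert v T)"
proof -
  have "v \<notin> T" using v by (simp add: ext_nodes_def)
  then have "T \<noteq> full_tree L"
    using tree_subset[OF T'] by (auto simp: full_tree_def)
  then have g: "1 / 2 \<le> grow_prob L T" by (simp add: grow_prob_def)
  have "0 < card (ext_nodes T)" using v finite_ext_nodes[OF T] card_gt_0_iff by blast
  moreover have "real (card (ext_nodes T)) \<le> real (2 ^ L)"
    unfolding of_nat_le_iff card_ext_nodes[OF T] by (rule card_tree_le[OF T])
  moreover have "S_grow T (insert v T) = 1 / real (card (ext_nodes T))"
    using v by (auto simp: S_grow_def)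
  ultimately have s: "1 / 2 ^ L \<le> S_grow T (insert v T)"
    by (simp add: frac_le)
  have "1 / 2 ^ (L + 1) = 1 / 2 * (1 / 2 ^ L :: real)" by simp
  also have "\<dots> \<le> grow_prob L T * S_grow T (insert v T)"
    using g s by (intro mult_mono) auto
  also have "\<dots> \<le> proposal L T (insert v T)"
    using S_prune_nonneg grow_prob_bounds[of L T] by (simp add: proposal_def)
  finally show ?thesis .
qed

lemma proposal_prune_ge:
  assumes T: "T \<in> cart_trees L" and v: "v \<in> preterminal T"
  shows "1 / 2 ^ (L + 1) \<le> proposal L T (T - {v})"
proof -
  have "v \<in> T" "v \<noteq> (-1, 0)" using v by (auto simp: preterminal_def)
  then have "T \<noteq> null_tree" by (auto simp: null_tree_def)
  then have g: "1 / 2 \<le> 1 - grow_prob L T" by (simp add: grow_prob_def)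
  have "0 < card (preterminal T)" using v finite_preterminal[OF T] card_gt_0_iff by blast
  moreover have "card (preterminal T) \<le> 2 ^ L"
    using card_mono[OF tree_finite[OF T] preterminal_subset] card_tree_le[OF T] by simp
  then have "real (card (preterminal T)) \<le> real (2 ^ L)" by (simp only: of_nat_le_iff)
  moreover have "S_prune T (T - {v}) = 1 / real (card (preterminal T))"
    using v by (auto simp: S_prune_def)
  ultimately have s: "1 / 2 ^ L \<le> S_prune T (T - {v})"
    by (simp add: frac_le)
  have "1 / 2 ^ (L + 1) = 1 / 2 * (1 / 2 ^ L :: real)" by simp
  also have "\<dots> \<le> (1 - grow_prob L T) * S_prune T (T - {v})"
    using g s by (intro mult_mono) auto
  also have "\<dots> \<le> proposal L T (T - {v})"
    using S_grow_nonneg grow_prob_bounds[of L T] by (simp add: proposal_def)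
  finally show ?thesis .
qed

section \<open>Orthogonality of the sampled Haar functions\<close>

text \<open>On the grid a Haar function at scale \<open>l\<close> is constant on blocks of \<open>m\<close> consecutive points, half its support. This is
  its sign on the block with index \<open>q\<close>: \<open>1\<close> on the first half of the \<open>k\<close>-th support, \<open>-1\<close> on the second.\<close>

definition half_sign :: "nat \<Rightarrow> nat \<Rightarrow> real" where
  "half_sign k q = (if q = 2 * k then 1 else 0) - (if q = 2 * k + 1 then 1 else 0)"

text \<open>The supports are open on the left and closed on the right, and grid points are counted from \<open>1\<close>. Hence
  the point with index \<open>Suc j\<close> belongs to block \<open>j div m\<close>.\<close>

lemma mother_eq_half_sign:
  assumes "0 < m"
  shows "mother (real (Suc j) / real (2 * m) - real k) = half_sign k (j div m)"
proof -
  have m: "0 < real m" using assms by simp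
  have div: "j div m = q \<longleftrightarrow> q * m \<le> j \<and> j < q * m + m" for q
    using assms by (auto simp: div_nat_eqI algebra_simps dividend_less_times_div)
  let ?x = "real (Suc j) / real (2 * m) - real k"
  have a: "0 < ?x \<longleftrightarrow> 2 * k * m \<le> j"
  proof -
    have "0 < ?x \<longleftrightarrow> real (2 * k * m) < real (Suc j)" using m by (simp add: field_simps)
    then show ?thesis unfolding of_nat_less_iff by linarith
  qed
  have b: "?x \<le> 1 / 2 \<longleftrightarrow> j < 2 * k * m + m"
  proof -
    have eq: "real (2 * k * m + m) / real (2 * m) = real k + 1 / 2" using m by (simp add: field_simps)
    have "?x \<le> 1 / 2 \<longleftrightarrow> real (Suc j) / real (2 * m) \<le> real (2 * k * m + m) / real (2 * m)"
      unfolding eq by linarith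
    also have "\<dots> \<longleftrightarrow> real (Suc j) \<le> real (2 * k * m + m)"
      using m by (simp only: divide_le_cancel) simp
    finally have "?x \<le> 1 / 2 \<longleftrightarrow> real (Suc j) \<le> real (2 * k * m + m)" .
    then show ?thesis unfolding of_nat_le_iff by linarith
  qed
  have c: "?x \<le> 1 \<longleftrightarrow> j < 2 * k * m + 2 * m"
  proof -
    have "?x \<le> 1 \<longleftrightarrow> real (Suc j) \<le> real (2 * k * m + 2 * m)" using m by (simp add: field_simps)
    then show ?thesis unfolding of_nat_le_iff by linarith
  qed
  have "?x \<in> {0<..1/2} \<longleftrightarrow> j div m = 2 * k"
    using a b div[of "2 * k"] by simp
  moreover have "?x \<in> {1/2<..1} \<longleftrightarrow> j div m = 2 * k + 1"
  proof -
    have "?x \<in> {1/2<..1} \<longleftrightarrow> \<not> ?x \<le> 1 / 2 \<and> ?x \<le> 1" by (simp only: greaterThanAtMost_iff not_le)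
    also have "\<dots> \<longleftrightarrow> j div m = 2 * k + 1"
      unfolding b c div by (auto simp: algebra_simps)
    finally show ?thesis .
  qed
  ultimately show ?thesis
    by (simp add: mother_def half_sign_def indicator_def)
qed

lemma sum_block:
  fixes g :: "nat \<Rightarrow> real"
  assumes "0 < m" "q * m + m \<le> n"
  shows "(\<Sum>j<n. (if j div m = q then 1 else 0) * g j) = (\<Sum>j\<in>{q * m..<q * m + m}. g j)"
proof -
  have div: "j div m = q \<longleftrightarrow> q * m \<le> j \<and> j < q * m + m" for j
    using assms by (auto simp: div_nat_eqI algebra_simps dividend_less_times_div)
  have "(\<Sum>j<n. (if j div m = q then 1 else 0) * g j) = (\<Sum>j\<in>{j\<in>{..<n}. j div m = q}. g j)"
    by (subst sum.inter_filter) (auto intro!: sum.cong)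
  also have "{j\<in>{..<n}. j div m = q} = {q * m..<q * m + m}"
    using assms by (auto simp: div)
  finally show ?thesis .
qed

text \<open>The two halves of a Haar function cancel against anything constant on its support.\<close>

lemma sum_half_sign_const:
  fixes g :: "nat \<Rightarrow> real"
  assumes m: "0 < m" and n: "(2 * k + 2) * m \<le> n"
    and g: "\<And>j. j div (2 * m) = k \<Longrightarrow> g j = c"
  shows "(\<Sum>j<n. half_sign k (j div m) * g j) = 0"
proof -
  have kk: "2 * k * m + m \<le> n" "(2 * k + 1) * m + m \<le> n" using n by (simp_all add: algebra_simps)
  have in_block: "j div (2 * m) = k" if "2 * k * m \<le> j" "j < 2 * k * m + 2 * m" for j
    using that m by (intro div_nat_eqI) (auto simp: algebra_simps)
  have "(\<Sum>j<n. half_sign k (j div m) * g j)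
      = (\<Sum>j\<in>{2 * k * m..<2 * k * m + m}. g j) - (\<Sum>j\<in>{(2 * k + 1) * m..<(2 * k + 1) * m + m}. g j)"
    unfolding half_sign_def left_diff_distrib sum_subtractf
    using sum_block[OF m kk(1), of g] sum_block[OF m kk(2), of g] by simp
  also have "(\<Sum>j\<in>{2 * k * m..<2 * k * m + m}. g j) = (\<Sum>j\<in>{2 * k * m..<2 * k * m + m}. c)"
    by (intro sum.cong refl g in_block) auto
  also have "(\<Sum>j\<in>{(2 * k + 1) * m..<(2 * k + 1) * m + m}. g j)
      = (\<Sum>j\<in>{(2 * k + 1) * m..<(2 * k + 1) * m + m}. c)"
    by (intro sum.cong refl g in_block) (auto simp: algebra_simps)
  finally show ?thesis by simp
qed

lemma sum_half_sign_square:
  assumes m: "0 < m" and n: "(2 * k + 2) * m \<le> n"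
  shows "(\<Sum>j<n. half_sign k (j div m) * half_sign k (j div m)) = 2 * real m"
proof -
  have kk: "2 * k * m + m \<le> n" "(2 * k + 1) * m + m \<le> n" using n by (simp_all add: algebra_simps)
  have "(\<Sum>j<n. half_sign k (j div m) * half_sign k (j div m))
      = (\<Sum>j<n. (if j div m = 2 * k then 1 else 0) * 1) + (\<Sum>j<n. (if j div m = 2 * k + 1 then 1 else 0) * 1)"
    unfolding sum.distrib[symmetric] by (intro sum.cong refl) (auto simp: half_sign_def)
  also have "\<dots> = real m + real m"
    using sum_block[OF m kk(1), of "\<lambda>_. 1"] sum_block[OF m kk(2), of "\<lambda>_. 1"] by simp
  finally show ?thesis by simp
qed

lemma design_root: "0 < n \<Longrightarrow> j < n \<Longrightarrow> design n (Suc j) (-1, 0) = 1"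
  by (simp add: design_def grid_def)

lemma design_node:
  assumes n: "n = 2 ^ (M + 1)" and l: "l < M"
  shows "design n (Suc j) (int l, k) = 2 powr (l / 2) * half_sign k (j div 2 ^ (M - l))"
proof -
  let ?m = "2 ^ (M - l) :: nat"
  have "n = 2 ^ l * (2 * ?m)"
    using n l by (simp add: power_add[symmetric])
  then have "2 ^ l * (real (Suc j) / real n) = real (Suc j) / real (2 * ?m)" by simp
  then show ?thesis
    using mother_eq_half_sign[of ?m j k] by (simp add: design_def grid_def)
qed

text \<open>At different scales the coarser function is constant on the support of the finer one, where the
  finer one sums to zero; at the same scale the supports are disjoint. The depth bound makes each half-support
  consist of whole grid blocks.\<close>

lemma design_orthogonal:
  assumes n: "n = 2 ^ (M + 1)" and v: "v \<in> nodes M" and w: "w \<in> nodes M"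
  shows "(\<Sum>i\<in>{1..n}. design n i v * design n i w) = (if v = w then real n else 0)"
proof -
  have shift: "(\<Sum>i\<in>{1..n}. f i) = (\<Sum>j<n. f (Suc j))" for f :: "nat \<Rightarrow> real"
    by (simp add: sum.atLeast1_atMost_eq lessThan_atLeast0)
  have n0: "0 < n" using n by simp
  have fits: "(2 * k + 2) * 2 ^ (M - l) \<le> n" if "l < M" "k < 2 ^ l" for l k :: nat
  proof -
    have "(2 * k + 2) * 2 ^ (M - l) \<le> (2 * 2 ^ l) * (2 ^ (M - l) :: nat)"
      using that by (intro mult_right_mono) auto
    also have "\<dots> = n" using that n by (simp add: power_add[symmetric])
    finally show ?thesis .
  qed
  have root: "(\<Sum>j<n. design n (Suc j) (int l, k) * design n (Suc j) (-1, 0)) = 0"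
    if "l < M" "k < 2 ^ l" for l k
  proof -
    have "(\<Sum>j<n. half_sign k (j div 2 ^ (M - l)) * 1) = 0"
      using that by (intro sum_half_sign_const fits) auto
    then have "(\<Sum>j<n. 2 powr (l / 2) * (half_sign k (j div 2 ^ (M - l)) * 1)) = 0"
      by (simp add: sum_distrib_left[symmetric])
    then show ?thesis using that n0 by (simp add: design_root design_node[OF n])
  qed
  have finer: "(\<Sum>j<n. design n (Suc j) (int l, k) * design n (Suc j) (int l', k')) = 0"
    if "l < M" "k < 2 ^ l" "l' < l" "k' < 2 ^ l'" for l k l' k'
  proof -
    let ?m = "2 ^ (M - l) :: nat" and ?m' = "2 ^ (M - l') :: nat" and ?r = "2 ^ (l - l' - 1) :: nat"
    have "?m' = (2 * ?m) * ?r"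
      using that by (simp add: power_add[symmetric] power_Suc[symmetric] del: power_Suc)
    then have "j div ?m' = (j div (2 * ?m)) div ?r" for j
      by (simp only: div_mult2_eq)
    then have "(\<Sum>j<n. half_sign k (j div ?m) * half_sign k' (j div ?m')) = 0"
      using that by (intro sum_half_sign_const[where c = "half_sign k' (k div ?r)"] fits) auto
    then have "(\<Sum>j<n. (2 powr (l / 2) * 2 powr (l' / 2))
        * (half_sign k (j div ?m) * half_sign k' (j div ?m'))) = 0"
      by (simp add: sum_distrib_left[symmetric])
    then show ?thesis using that by (simp add: design_node[OF n] mult_ac)
  qed
  have level: "(\<Sum>j<n. design n (Suc j) (int l, k) * design n (Suc j) (int l, k'))
      = (if k = k' then real n else 0)" if "l < M" "k < 2 ^ l" "k' < 2 ^ l" for l k k'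
  proof -
    let ?m = "2 ^ (M - l) :: nat"
    have sq: "2 powr (real l / 2) * 2 powr (real l / 2) = 2 ^ l"
      by (simp add: powr_add[symmetric] powr_realpow)
    have "(\<Sum>j<n. design n (Suc j) (int l, k) * design n (Suc j) (int l, k'))
        = (\<Sum>j<n. 2 ^ l * (half_sign k (j div ?m) * half_sign k' (j div ?m)))"
      unfolding sq[symmetric] using that by (simp add: design_node[OF n] mult_ac)
    also have "\<dots> = 2 ^ l * (\<Sum>j<n. half_sign k (j div ?m) * half_sign k' (j div ?m))"
      by (simp add: sum_distrib_left)
    also have "\<dots> = (if k = k' then real n else 0)"
    proof (cases "k = k'")
      case True
      then have "2 ^ l * (\<Sum>j<n. half_sign k (j div ?m) * half_sign k' (j div ?m))
          = 2 ^ l * (2 * real ?m)"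
        using sum_half_sign_square[OF _ fits[OF that(1,2)]] by simp
      also have "\<dots> = real n" using that n by (simp add: power_add[symmetric])
      finally show ?thesis using True by simp
    next
      case False
      then have "half_sign k q * half_sign k' q = 0" for q
        by (auto simp: half_sign_def)
      then show ?thesis using False by (simp only: sum.neutral_const mult_zero_right if_False)
    qed
    finally show ?thesis .
  qed
  show ?thesis
    unfolding shift using v
  proof (cases rule: node_cases)
    case 1
    from w show "(\<Sum>j<n. design n (Suc j) v * design n (Suc j) w) = (if v = w then real n else 0)"
    proof (cases rule: node_cases)
      case 1
      then show ?thesis using \<open>v = (-1, 0)\<close> n0 by (simp add: design_root)
    next
      case (2 l k)
      then show ?thesis using root[of l k] \<open>v = (-1, 0)\<close> by (simp add: mult.commute)
    qed
  next
    case v: (2 l k)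
    from w show "(\<Sum>j<n. design n (Suc j) v * design n (Suc j) w) = (if v = w then real n else 0)"
    proof (cases rule: node_cases)
      case 1
      then show ?thesis using root[of l k] v by simp
    next
      case w: (2 l' k')
      consider "l' < l" | "l < l'" | "l = l'" by linarith
      then show ?thesis
      proof cases
        case 1
        then show ?thesis using finer[of l k l' k'] v w by simp
      next
        case 2
        then show ?thesis using finer[of l' k' l k] v w by (simp add: mult.commute)
      next
        case 3
        then show ?thesis using level[of l k k'] v w by simp
      qed
    qed
  qed
qed

section \<open>Gaussian integrals\<close>

interpretation std_normal: prob_space std_normal
  by (rule prob_space_normal_density) simp

text \<open>Completing the square. The case \<open>a = n\<close> integrates out a coefficient, and the case \<open>a = 0\<close> is the moment
  generating function behind the tail bound.\<close>

lemma gaussian_exp_quadratic: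
  fixes s a :: real
  assumes a: "0 \<le> a"
  shows "has_bochner_integral std_normal (\<lambda>b. exp (s * b - a * b\<^sup>2 / 2))
      (exp (s\<^sup>2 / (2 * (1 + a))) / sqrt (1 + a))"
proof -
  let ?m = "s / (1 + a)" and ?\<sigma> = "1 / sqrt (1 + a)"
  have a1: "0 < 1 + a" using a by simp
  have "has_bochner_integral lborel (normal_density ?m ?\<sigma>) 1"
    using a1 by (simp add: has_bochner_integral_iff)
  then have "has_bochner_integral lborel
      (\<lambda>b. exp (s\<^sup>2 / (2 * (1 + a))) / sqrt (1 + a) * normal_density ?m ?\<sigma> b)
      (exp (s\<^sup>2 / (2 * (1 + a))) / sqrt (1 + a) * 1)"
    by (rule has_bochner_integral_mult_right)
  also have "(\<lambda>b. exp (s\<^sup>2 / (2 * (1 + a))) / sqrt (1 + a) * normal_density ?m ?\<sigma> b)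
      = (\<lambda>b. std_normal_density b *\<^sub>R exp (s * b - a * b\<^sup>2 / 2))"
  proof
    fix b
    have "r * (b - s / r)\<^sup>2 = r * b\<^sup>2 - 2 * s * b + s\<^sup>2 / r" if "0 < r" for r
      using that by (simp add: power2_eq_square field_simps)
    from this[OF a1] have sq: "(1 + a) * (b - ?m)\<^sup>2 = (1 + a) * b\<^sup>2 - 2 * s * b + s\<^sup>2 / (1 + a)" .
    have "normal_density ?m ?\<sigma> b = sqrt (1 + a) / sqrt (2 * pi) * exp (- ((1 + a) * (b - ?m)\<^sup>2) / 2)"
      using a1 by (simp add: normal_density_def power_divide real_sqrt_divide field_simps)
    then have "exp (s\<^sup>2 / (2 * (1 + a))) / sqrt (1 + a) * normal_density ?m ?\<sigma> b
        = (exp (s\<^sup>2 / (2 * (1 + a))) * exp (- ((1 + a) * (b - ?m)\<^sup>2) / 2)) / sqrt (2 * pi)"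
      using a1 by simp
    also have "exp (s\<^sup>2 / (2 * (1 + a))) * exp (- ((1 + a) * (b - ?m)\<^sup>2) / 2)
        = exp (- b\<^sup>2 / 2) * exp (s * b - a * b\<^sup>2 / 2)"
    proof -
      have half: "s\<^sup>2 / (2 * (1 + a)) = s\<^sup>2 / (1 + a) / 2" by simp
      show ?thesis
        unfolding sq exp_add[symmetric] half by (simp add: algebra_simps add_divide_distrib diff_divide_distrib)
    qed
    finally show "exp (s\<^sup>2 / (2 * (1 + a))) / sqrt (1 + a) * normal_density ?m ?\<sigma> b
        = std_normal_density b *\<^sub>R exp (s * b - a * b\<^sup>2 / 2)"
      by (simp add: std_normal_density_def)
  qed
  finally show ?thesis
    by (intro has_bochner_integral_density) auto
qed

lemma gaussian_exp_quadratic_prod: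
  fixes s :: "'i \<Rightarrow> real"
  assumes "finite I" "0 \<le> a"
  shows "integrable (\<Pi>\<^sub>M i\<in>I. std_normal) (\<lambda>b. \<Prod>i\<in>I. exp (s i * b i - a * (b i)\<^sup>2 / 2))"
    and "(\<integral>b. (\<Prod>i\<in>I. exp (s i * b i - a * (b i)\<^sup>2 / 2)) \<partial>(\<Pi>\<^sub>M i\<in>I. std_normal))
      = (\<Prod>i\<in>I. exp ((s i)\<^sup>2 / (2 * (1 + a))) / sqrt (1 + a))"
proof -
  interpret product_sigma_finite "\<lambda>_::'i. std_normal"
    by (simp add: product_sigma_finite_def std_normal.sigma_finite_measure_axioms)
  have int: "integrable std_normal (\<lambda>b. exp (s i * b - a * b\<^sup>2 / 2))"
    and val: "(\<integral>b. exp (s i * b - a * b\<^sup>2 / 2) \<partial>std_normal)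
      = exp ((s i)\<^sup>2 / (2 * (1 + a))) / sqrt (1 + a)" for i
    using gaussian_exp_quadratic[OF assms(2), of "s i"]
    by (auto simp: has_bochner_integral_iff)
  show "integrable (\<Pi>\<^sub>M i\<in>I. std_normal) (\<lambda>b. \<Prod>i\<in>I. exp (s i * b i - a * (b i)\<^sup>2 / 2))"
    using assms(1) int by (rule product_integrable_prod)
  show "(\<integral>b. (\<Prod>i\<in>I. exp (s i * b i - a * (b i)\<^sup>2 / 2)) \<partial>(\<Pi>\<^sub>M i\<in>I. std_normal))
      = (\<Prod>i\<in>I. exp ((s i)\<^sup>2 / (2 * (1 + a))) / sqrt (1 + a))"
    using product_integral_prod[OF assms(1) int] val by simp
qed

text \<open>Markov's inequality for \<open>exp (l (\<Sum>i. a i * e i))\<close>, with the optimal \<open>l = t / V\<close>.\<close>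

lemma gaussian_linear_tail:
  fixes a :: "'i \<Rightarrow> real"
  assumes I: "finite I" and t: "0 < t" and V: "(\<Sum>i\<in>I. (a i)\<^sup>2) = V" "0 < V"
  shows "measure (\<Pi>\<^sub>M i\<in>I. std_normal) {e \<in> space (\<Pi>\<^sub>M i\<in>I. std_normal). t \<le> (\<Sum>i\<in>I. a i * e i)}
      \<le> exp (- t\<^sup>2 / (2 * V))"
proof -
  let ?M = "\<Pi>\<^sub>M i\<in>I. std_normal"
  interpret prob_space ?M by (intro prob_space_PiM std_normal.prob_space_axioms)
  let ?l = "t / V"
  let ?u = "\<lambda>e. \<Prod>i\<in>I. exp ((?l * a i) * e i - 0 * (e i)\<^sup>2 / 2)"
  have u: "?u e = exp (?l * (\<Sum>i\<in>I. a i * e i))" for e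
    using I by (simp add: exp_sum sum_distrib_left mult.assoc)
  have "measure ?M {e \<in> space ?M. t \<le> (\<Sum>i\<in>I. a i * e i)}
      \<le> measure ?M {e \<in> space ?M. exp (?l * t) \<le> ?u e}"
  proof (intro finite_measure_mono)
    show "{e \<in> space ?M. t \<le> (\<Sum>i\<in>I. a i * e i)} \<subseteq> {e \<in> space ?M. exp (?l * t) \<le> ?u e}"
      unfolding u using t V by (auto intro!: mult_left_mono divide_right_mono)
    show "{e \<in> space ?M. exp (?l * t) \<le> ?u e} \<in> sets ?M"
      using borel_measurable_integrable[OF gaussian_exp_quadratic_prod(1)[OF I, of 0 "\<lambda>i. ?l * a i"]]
      by measurable
  qed
  also have "\<dots> \<le> (\<integral>e. ?u e \<partial>?M) / exp (?l * t)"
    by (intro integral_Markov_inequality_measure[of _ _ "{}"] gaussian_exp_quadratic_prod I)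
      (auto intro!: prod_nonneg)
  also have "(\<integral>e. ?u e \<partial>?M) = (\<Prod>i\<in>I. exp ((?l * a i)\<^sup>2 / (2 * (1 + 0))) / sqrt (1 + 0))"
    by (intro gaussian_exp_quadratic_prod I) simp
  also have "\<dots> = exp (\<Sum>i\<in>I. (?l * a i)\<^sup>2 / 2)" using I by (simp add: exp_sum)
  also have "(\<Sum>i\<in>I. (?l * a i)\<^sup>2 / 2) = ?l\<^sup>2 * V / 2"
    unfolding V(1)[symmetric] by (simp add: sum_distrib_left sum_divide_distrib power_mult_distrib power_divide)
  also have "exp (?l\<^sup>2 * V / 2) / exp (?l * t) = exp (?l\<^sup>2 * V / 2 - ?l * t)" by (simp add: exp_diff)
  also have "?l\<^sup>2 * V / 2 - ?l * t = - t\<^sup>2 / (2 * V)"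
    using V by (simp add: power2_eq_square field_simps)
  finally show ?thesis .
qed

section \<open>The marginal likelihood\<close>

definition corr :: "nat \<Rightarrow> (nat \<Rightarrow> real) \<Rightarrow> node \<Rightarrow> real" where
  "corr n Y v = (\<Sum>i\<in>{1..n}. design n i v * Y i)"

text \<open>Orthogonality of the columns removes all cross terms in the squared norm of the fitted signal, and the
  likelihood splits into one factor for each node.\<close>

lemma likelihood_eq:
  assumes n: "n = 2 ^ (M + 1)" and T: "T \<subseteq> nodes M"
  shows "likelihood n T \<beta> Y = (1 / sqrt (2 * pi)) ^ n * exp (- (\<Sum>i\<in>{1..n}. (Y i)\<^sup>2) / 2)
      * (\<Prod>v\<in>T. exp (corr n Y v * \<beta> v - real n * (\<beta> v)\<^sup>2 / 2))"
proof -
  have fin: "finite T" using T finite_nodes finite_subset by blast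
  let ?m = "\<lambda>i. \<Sum>v\<in>T. design n i v * \<beta> v"
  have cross: "(\<Sum>i\<in>{1..n}. Y i * ?m i) = (\<Sum>v\<in>T. corr n Y v * \<beta> v)"
    unfolding sum_distrib_left by (subst sum.swap) (simp add: corr_def sum_distrib_left mult_ac)
  have "(\<Sum>i\<in>{1..n}. (?m i)\<^sup>2)
      = (\<Sum>i\<in>{1..n}. \<Sum>v\<in>T. \<Sum>w\<in>T. \<beta> v * \<beta> w * (design n i v * design n i w))"
    by (simp add: power2_eq_square sum_product mult_ac)
  also have "\<dots> = (\<Sum>v\<in>T. \<Sum>w\<in>T. \<beta> v * \<beta> w * (\<Sum>i\<in>{1..n}. design n i v * design n i w))"
    unfolding sum_distrib_left by (subst sum.swap, intro sum.cong refl, rule sum.swap)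
  also have "\<dots> = (\<Sum>v\<in>T. \<Sum>w\<in>T. if v = w then \<beta> v * \<beta> w * real n else 0)"
    using T by (intro sum.cong refl, subst design_orthogonal[OF n]) auto
  also have "\<dots> = (\<Sum>v\<in>T. real n * (\<beta> v)\<^sup>2)"
    using fin by (simp add: power2_eq_square mult_ac)
  finally have square: "(\<Sum>i\<in>{1..n}. (?m i)\<^sup>2) = (\<Sum>v\<in>T. real n * (\<beta> v)\<^sup>2)" .
  have "likelihood n T \<beta> Y = (\<Prod>i\<in>{1..n}. 1 / sqrt (2 * pi) * exp (- (Y i - ?m i)\<^sup>2 / 2))"
    by (simp add: likelihood_def normal_density_def)
  also have "\<dots> = (1 / sqrt (2 * pi)) ^ n * exp (\<Sum>i\<in>{1..n}. - (Y i - ?m i)\<^sup>2 / 2)"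
    by (simp only: prod.distrib prod_constant exp_sum finite_atLeastAtMost card_atLeastAtMost) simp
  also have "(\<Sum>i\<in>{1..n}. - (Y i - ?m i)\<^sup>2 / 2)
      = - (\<Sum>i\<in>{1..n}. (Y i)\<^sup>2) / 2 + (\<Sum>i\<in>{1..n}. Y i * ?m i) - (\<Sum>i\<in>{1..n}. (?m i)\<^sup>2) / 2"
    by (simp add: power2_diff sum_divide_distrib sum_negf[symmetric] sum.distrib[symmetric]
        sum_subtractf[symmetric] diff_divide_distrib add_divide_distrib mult.assoc algebra_simps del: sum_negf sum.distrib)
  also have "\<dots> = - (\<Sum>i\<in>{1..n}. (Y i)\<^sup>2) / 2 + (\<Sum>v\<in>T. corr n Y v * \<beta> v - real n * (\<beta> v)\<^sup>2 / 2)"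
    unfolding cross square by (simp add: sum_subtractf sum_divide_distrib)
  also have "exp \<dots> = exp (- (\<Sum>i\<in>{1..n}. (Y i)\<^sup>2) / 2)
      * (\<Prod>v\<in>T. exp (corr n Y v * \<beta> v - real n * (\<beta> v)\<^sup>2 / 2))"
    by (simp only: exp_add exp_sum[OF fin])
  finally show ?thesis by (simp only: mult.assoc)
qed

lemma marginal_likelihood_eq:
  assumes n: "n = 2 ^ (M + 1)" and T: "T \<subseteq> nodes M"
  shows "marginal_likelihood n Y T = (1 / sqrt (2 * pi)) ^ n * exp (- (\<Sum>i\<in>{1..n}. (Y i)\<^sup>2) / 2)
      * (\<Prod>v\<in>T. exp ((corr n Y v)\<^sup>2 / (2 * (1 + real n))) / sqrt (1 + real n))"
proof -
  have fin: "finite T" using T finite_nodes finite_subset by blast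
  show ?thesis
    unfolding marginal_likelihood_def likelihood_eq[OF assms]
    using gaussian_exp_quadratic_prod(2)[OF fin, of "real n" "corr n Y"] by simp
qed

section \<open>Product measures on trees\<close>

definition tree_measure :: "nat \<Rightarrow> (node \<Rightarrow> real) \<Rightarrow> node set \<Rightarrow> real" where
  "tree_measure L w T =
     (if T \<in> cart_trees L then prod w T / (\<Sum>U\<in>cart_trees L. prod w U) else 0)"

lemma sum_Pow_power_card:
  fixes r :: real
  assumes "finite A"
  shows "(\<Sum>S\<in>Pow A. r ^ card S) = (1 + r) ^ card A"
  using assms
proof induction
  case (insert a A)
  have "(\<Sum>S\<in>Pow (insert a A). r ^ card S)
      = (\<Sum>S\<in>Pow A. r ^ card S) + (\<Sum>S\<in>insert a ` Pow A. r ^ card S)"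
    unfolding Pow_insert using insert by (intro sum.union_disjoint) auto
  also have "(\<Sum>S\<in>insert a ` Pow A. r ^ card S) = (\<Sum>S\<in>Pow A. r ^ card (insert a S))"
    using insert by (intro sum.reindex_cong[OF _ refl refl]) (auto simp: inj_on_def)
  also have "\<dots> = (\<Sum>S\<in>Pow A. r * r ^ card S)"
  proof (intro sum.cong refl)
    fix S assume "S \<in> Pow A"
    then have "finite S" "a \<notin> S" using insert finite_subset by auto
    then show "r ^ card (insert a S) = r * r ^ card S" by simp
  qed
  finally show ?case using insert by (simp add: sum_distrib_left[symmetric] algebra_simps)
qed simp

text \<open>A product measure on trees with its peak at \<open>B\<close>: to include a node outside \<open>B\<close>, or to omit one in \<open>B\<close>,
  costs at least a factor \<open>r\<close>. The bound \<open>ratio_small\<close> ensures \<open>(1 + r) ^ (2 ^ L) \<le> 2\<close>, so that the total mass of all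
  such deviations stays comparable to that of the tree they start from.\<close>

locale peaked_tree_measure =
  fixes L :: nat and w :: "node \<Rightarrow> real" and B :: "node set" and r :: real
  assumes weight_pos: "v \<in> nodes L \<Longrightarrow> 0 < w v"
    and mode: "B \<in> cart_trees L"
    and low: "v \<in> nodes L \<Longrightarrow> v \<notin> B \<Longrightarrow> w v \<le> r"
    and high: "v \<in> B \<Longrightarrow> 1 \<le> r * w v"
    and ratio_pos: "0 < r"
    and ratio_small: "r * 2 ^ L \<le> 1 / 2"
begin

abbreviation "\<mu> \<equiv> tree_measure L w"

text \<open>The set \<open>y\<close> lies on a shortest path from \<open>x\<close> to \<open>B\<close> on which single nodes are added or removed.\<close>

definition via :: "node set \<Rightarrow> node set \<Rightarrow> bool" where
  "via x y \<longleftrightarrow> x \<inter> B \<subseteq> y \<and> y \<subseteq> x \<union> B"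

lemma prod_weight_pos: "T \<in> cart_trees L \<Longrightarrow> 0 < prod w T"
  using tree_subset weight_pos by (intro prod_pos) blast

lemma total_pos: "0 < (\<Sum>U\<in>cart_trees L. prod w U)"
proof (rule sum_pos)
  show "cart_trees L \<noteq> {}" using null_tree_in by blast
qed (auto intro: prod_weight_pos)

lemma measure_pos: "T \<in> cart_trees L \<Longrightarrow> 0 < \<mu> T"
  using prod_weight_pos total_pos by (simp add: tree_measure_def)

lemma measure_sum: "sum \<mu> (cart_trees L) = 1"
  using total_pos by (simp add: tree_measure_def sum_divide_distrib[symmetric])

lemma ratio_le_1: "r \<le> 1"
proof -
  have "r * 1 \<le> r * 2 ^ L" using ratio_pos by (intro mult_left_mono) auto
  then show ?thesis using ratio_small by simp
qed

lemma measure_via_le: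
  assumes x: "x \<in> cart_trees L" and y: "y \<in> cart_trees L" and xy: "via x y"
  shows "\<mu> x \<le> \<mu> y * r ^ card ((x - y) \<union> (y - x))"
proof -
  have fin: "finite x" "finite y" using x y tree_finite by blast+
  have pos: "0 < w v" if "v \<in> x \<union> y" for v
    using that x y tree_subset weight_pos by blast
  have "prod w (x - y) \<le> (\<Prod>v\<in>x - y. r)"
    using x xy tree_subset[OF x] by (intro prod_mono) (auto simp: via_def intro!: low less_imp_le[OF pos])
  then have a: "prod w (x - y) \<le> r ^ card (x - y)" by simp
  have "(\<Prod>v\<in>y - x. 1) \<le> (\<Prod>v\<in>y - x. r * w v)"
    using xy by (intro prod_mono) (auto simp: via_def intro!: high)
  then have b: "1 \<le> r ^ card (y - x) * prod w (y - x)" by (simp add: prod.distrib)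
  have "prod w x = prod w (x \<inter> y) * prod w (x - y)"
    using fin by (subst prod.union_disjoint[symmetric]) (auto intro!: prod.cong)
  also have "\<dots> \<le> prod w (x \<inter> y) * (r ^ card (x - y) * (r ^ card (y - x) * prod w (y - x)))"
  proof (rule mult_left_mono)
    have "prod w (x - y) * 1 \<le> r ^ card (x - y) * (r ^ card (y - x) * prod w (y - x))"
      using a b ratio_pos by (intro mult_mono) auto
    then show "prod w (x - y) \<le> r ^ card (x - y) * (r ^ card (y - x) * prod w (y - x))" by simp
    show "0 \<le> prod w (x \<inter> y)" using pos by (intro prod_nonneg) (auto intro: less_imp_le)
  qed
  also have "\<dots> = (prod w (x \<inter> y) * prod w (y - x)) * r ^ (card (x - y) + card (y - x))"
    by (simp add: power_add)
  also have "prod w (x \<inter> y) * prod w (y - x) = prod w y"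
    using fin by (subst prod.union_disjoint[symmetric]) (auto intro!: prod.cong)
  also have "card (x - y) + card (y - x) = card ((x - y) \<union> (y - x))"
    using fin by (intro card_Un_disjoint[symmetric]) auto
  finally have "prod w x \<le> prod w y * r ^ card ((x - y) \<union> (y - x))" .
  then show ?thesis
    using x y total_pos by (simp add: tree_measure_def divide_right_mono)
qed

lemma measure_via_mono:
  assumes "x \<in> cart_trees L" "y \<in> cart_trees L" "via x y"
  shows "\<mu> x \<le> \<mu> y"
proof -
  have "r ^ card ((x - y) \<union> (y - x)) \<le> 1"
    using ratio_pos ratio_le_1 by (intro power_le_one) auto
  then have "\<mu> y * r ^ card ((x - y) \<union> (y - x)) \<le> \<mu> y * 1"
    using measure_pos[OF assms(2)] by (intro mult_left_mono) auto
  with measure_via_le[OF assms] show ?thesis by simp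
qed

text \<open>A tree \<open>x\<close> is determined by its symmetric difference from \<open>y\<close>, so the sum is at most
  \<open>\<mu> y\<close> times the sum of \<open>r ^ |S|\<close> over all sets \<open>S\<close> of nodes, which is \<open>(1 + r) ^ (2 ^ L)\<close>.\<close>

lemma mass_via_le:
  assumes y: "y \<in> cart_trees L"
  shows "(\<Sum>x | x \<in> cart_trees L \<and> via x y. \<mu> x) \<le> 2 * \<mu> y"
proof -
  let ?A = "{x. x \<in> cart_trees L \<and> via x y}" and ?sd = "\<lambda>x. (x - y) \<union> (y - x)"
  have finA: "finite ?A" using finite_cart_trees[of L] by simp
  have inj: "inj_on ?sd ?A" by (rule inj_onI) blast
  have sub: "?sd ` ?A \<subseteq> Pow (nodes L)" using tree_subset y by blast
  have "(\<Sum>x\<in>?A. r ^ card (?sd x)) = (\<Sum>S\<in>?sd ` ?A. r ^ card S)"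
    using inj by (simp add: sum.reindex)
  also have "\<dots> \<le> (\<Sum>S\<in>Pow (nodes L). r ^ card S)"
    using sub ratio_pos by (intro sum_mono2) auto
  also have "\<dots> = (1 + r) ^ (2 ^ L)" by (simp add: sum_Pow_power_card card_nodes)
  also have "\<dots> \<le> exp r ^ (2 ^ L)"
    using exp_ge_add_one_self ratio_pos by (intro power_mono) auto
  also have "\<dots> = exp (r * 2 ^ L)" by (simp add: exp_of_nat_mult[symmetric] mult.commute)
  also have "\<dots> \<le> exp (1 / 2)" using ratio_small by simp
  also have "\<dots> \<le> 2" by (rule exp_half_le2)
  finally have "(\<Sum>x\<in>?A. r ^ card (?sd x)) \<le> 2" .
  then have "\<mu> y * (\<Sum>x\<in>?A. r ^ card (?sd x)) \<le> \<mu> y * 2"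
    using measure_pos[OF y] by (intro mult_left_mono) auto
  moreover have "sum \<mu> ?A \<le> (\<Sum>x\<in>?A. \<mu> y * r ^ card (?sd x))"
    using y by (intro sum_mono measure_via_le) auto
  ultimately show ?thesis by (simp add: sum_distrib_left mult.commute)
qed

text \<open>All trees are routed through the end point \<open>B\<close>.\<close>

lemma measure_mode: "1 / 2 \<le> \<mu> B"
proof -
  have "{x. x \<in> cart_trees L \<and> via x B} = cart_trees L" by (auto simp: via_def)
  then show ?thesis using mass_via_le[OF mode] measure_sum by simp
qed

lemma descent_step:
  assumes x: "x \<in> cart_trees L" and ne: "x \<noteq> B"
  obtains y where "y \<in> cart_trees L" "via x y"
    "card ((x - B) \<union> (B - x)) = Suc (card ((y - B) \<union> (B - y)))"
    "x \<noteq> y"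
    "1 / 2 ^ (L + 1) \<le> proposal L x y" "1 / 2 ^ (L + 1) \<le> proposal L y x"
proof (cases "x \<subseteq> B")
  case False
  obtain v where v: "v \<in> x - B" "v \<in> preterminal x" "x - {v} \<in> cart_trees L"
    using prune_step[OF x mode False] by blast
  let ?y = "x - {v}"
  have "(?y - B) \<union> (B - ?y) = ((x - B) \<union> (B - x)) - {v}" using v by auto
  moreover have "finite ((x - B) \<union> (B - x))" using tree_finite[OF x] tree_finite[OF mode] by simp
  ultimately have "card ((x - B) \<union> (B - x)) = Suc (card ((?y - B) \<union> (B - ?y)))"
    using v card_Suc_Diff1[of "(x - B) \<union> (B - x)" v] by simp
  moreover have "1 / 2 ^ (L + 1) \<le> proposal L ?y x"
  proof -
    have "insert v ?y = x" using v by auto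
    then show ?thesis
      using proposal_grow_ge[OF v(3) ext_nodes_remove[OF x v(2,3)]] x by simp
  qed
  moreover have "1 / 2 ^ (L + 1) \<le> proposal L x ?y" by (rule proposal_prune_ge[OF x v(2)])
  ultimately show thesis using v by (intro that[of ?y]) (auto simp: via_def)
next
  case True
  then have "\<not> B \<subseteq> x" using ne by auto
  then obtain v where v: "v \<in> B - x" "v \<in> ext_nodes x" "insert v x \<in> cart_trees L"
    using grow_step[OF x mode] by blast
  let ?y = "insert v x"
  have "(?y - B) \<union> (B - ?y) = ((x - B) \<union> (B - x)) - {v}" using v by auto
  moreover have "finite ((x - B) \<union> (B - x))" using tree_finite[OF x] tree_finite[OF mode] by simp
  ultimately have "card ((x - B) \<union> (B - x)) = Suc (card ((?y - B) \<union> (B - ?y)))"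
    using v card_Suc_Diff1[of "(x - B) \<union> (B - x)" v] by simp
  moreover have "1 / 2 ^ (L + 1) \<le> proposal L ?y x"
  proof -
    have "?y - {v} = x" using v by auto
    then show ?thesis
      using proposal_prune_ge[OF v(3) preterminal_insert[OF x v(2,3)]] by simp
  qed
  moreover have "1 / 2 ^ (L + 1) \<le> proposal L x ?y" by (rule proposal_grow_ge[OF x v(2,3)])
  ultimately show thesis using v by (intro that[of ?y]) (auto simp: via_def)
qed

lemma metropolis_chain:
  "reversible_chain (cart_trees L) (metropolis (cart_trees L) \<mu> (proposal L)) \<mu>"
  by (intro metropolis_reversible proposal_nonneg proposal_sum_le)
    (auto simp: measure_pos measure_sum)

text \<open>The constant combines path length \<open>2 ^ L\<close>, mass factor \<open>2\<close>, proposal probability \<open>2 ^ -(L + 1)\<close> and another factor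
  \<open>2\<close> for laziness. Since the mass increases along each step towards \<open>B\<close>, the flow across the step is
  governed by the mass of its starting point.\<close>

lemma lazy_chain_contracting:
  "contracting_chain (cart_trees L) (lazy (metropolis (cart_trees L) \<mu> (proposal L))) \<mu>
     (1 - 1 / 2 ^ (2 * L + 3))"
proof -
  let ?P = "metropolis (cart_trees L) \<mu> (proposal L)"
  interpret reversible_chain "cart_trees L" ?P \<mu> by (rule metropolis_chain)
  let ?d = "\<lambda>x. card ((x - B) \<union> (B - x))"
  let ?ok = "\<lambda>x y. y \<in> cart_trees L \<and> via x y \<and> ?d x = Suc (?d y)
    \<and> x \<noteq> y \<and> 1 / 2 ^ (L + 1) \<le> proposal L x y \<and> 1 / 2 ^ (L + 1) \<le> proposal L y x"
  have "\<forall>x\<in>cart_trees L - {B}. \<exists>y. ?ok x y"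
  proof
    fix x assume "x \<in> cart_trees L - {B}"
    then have "x \<in> cart_trees L" "x \<noteq> B" by auto
    then show "\<exists>y. ?ok x y"
      by (rule descent_step) (intro exI conjI)
  qed
  from bchoice[OF this] obtain g where g_all: "\<forall>x\<in>cart_trees L - {B}. ?ok x (g x)"
    by (rule exE)
  have g: "?ok x (g x)" if "x \<in> cart_trees L" "x \<noteq> B" for x
    by (rule bspec[OF g_all]) (simp add: that)
  have descent: "1 / 2 ^ (L + 1) * mean (\<lambda>x. (f x - f B)\<^sup>2) \<le> real (2 ^ L) * 2 * dirichlet f" for f
  proof (rule poincare_by_descent[where d = ?d and g = g and R = via])
    show "B \<in> cart_trees L" by (rule mode)
    show "g x \<in> cart_trees L" "?d x = Suc (?d (g x))" if "x \<in> cart_trees L" "x \<noteq> B" for x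
      using g[OF that] by blast+
    show "via x x" for x by (simp add: via_def)
    show "via x y" if "x \<in> cart_trees L" "x \<noteq> B" "via (g x) y" for x y
      using g[OF that(1,2)] that(3) unfolding via_def by blast
    show "?d x \<le> 2 ^ L" if "x \<in> cart_trees L" for x
    proof -
      have "(x - B) \<union> (B - x) \<subseteq> nodes L" using tree_subset[OF that] tree_subset[OF mode] by blast
      then show ?thesis using card_mono[OF finite_nodes] card_nodes by metis
    qed
    show "(\<Sum>x | x \<in> cart_trees L \<and> via x y. \<mu> x) \<le> 2 * \<mu> y" if "y \<in> cart_trees L" for y
      by (rule mass_via_le[OF that])
    show "1 / 2 ^ (L + 1) \<le> ?P y (g y)" if y: "y \<in> cart_trees L" "y \<noteq> B" for y
    proof -
      let ?s = "1 / 2 ^ (L + 1) :: real"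
      note gy = g[OF y]
      have pos: "0 < \<mu> y" "0 < \<mu> (g y)" using measure_pos y gy by blast+
      have le: "\<mu> y \<le> \<mu> (g y)" using measure_via_mono y gy by blast
      have "\<mu> y * ?s \<le> \<mu> y * proposal L y (g y)"
        using gy pos by (intro mult_left_mono) auto
      moreover have "\<mu> y * ?s \<le> \<mu> (g y) * proposal L (g y) y"
        using gy pos le by (intro mult_mono) auto
      ultimately have "\<mu> y * ?s \<le> min (\<mu> y * proposal L y (g y)) (\<mu> (g y) * proposal L (g y) y)"
        by simp
      also have "\<dots> = \<mu> y * ?P y (g y)"
        using pos gy by (intro metropolis_flow[symmetric] proposal_nonneg) auto
      finally show ?thesis using pos by (simp only: mult_le_cancel_left_pos)
    qed
  qed auto
  show ?thesis
  proof (rule lazy_contracting)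
    show "(0::real) < 1 / 2 ^ (2 * L + 3)" by simp
    show "1 / 2 ^ (2 * L + 3) < (1::real)" by (simp add: one_less_power)
    fix f assume "mean f = 0"
    then have "mean (\<lambda>x. (f x)\<^sup>2) \<le> mean (\<lambda>x. (f x - f B)\<^sup>2)"
      using variance_le[of f "f B"] by simp
    then have "1 / 2 ^ (L + 1) * mean (\<lambda>x. (f x)\<^sup>2) \<le> 1 / 2 ^ (L + 1) * mean (\<lambda>x. (f x - f B)\<^sup>2)"
      by (intro mult_left_mono) auto
    with descent[of f] have le: "1 / 2 ^ (L + 1) * mean (\<lambda>x. (f x)\<^sup>2) \<le> 2 ^ L * 2 * dirichlet f"
      by simp
    have arith: "2 * (1 / (8 * (a * a))) * m \<le> D" if "0 < a" "1 / (2 * a) * m \<le> a * 2 * D"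
      for a m D :: real
      using that by (simp add: field_simps)
    have "2 * L + 3 = L + L + 3" by simp
    then have pow: "(2::real) ^ (2 * L + 3) = 8 * (2 ^ L * 2 ^ L)" "(2::real) ^ (L + 1) = 2 * 2 ^ L"
      by (simp_all only: power_add) simp_all
    show "2 * (1 / 2 ^ (2 * L + 3)) * mean (\<lambda>x. (f x)\<^sup>2) \<le> dirichlet f"
      using le unfolding pow by (intro arith[of "2 ^ L"]) simp_all
  qed
qed

end

section \<open>Mixing times\<close>

lemma tv_dist_le_iff:
  assumes "finite \<Omega>"
  shows "tv_dist \<Omega> \<mu> \<nu> \<le> e \<longleftrightarrow> (\<forall>E\<in>Pow \<Omega>. \<bar>sum \<mu> E - sum \<nu> E\<bar> \<le> e)"
  unfolding tv_dist_def using assms by (subst Max_le_iff) auto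

text \<open>Turns the maximum of infima over \<open>enat\<close> into quantifiers over natural numbers, which serves both the bound and
  the measurability of the event in the data.\<close>

lemma mixing_time_le_iff:
  assumes fin: "finite \<Omega>" "\<Omega> \<noteq> {}"
  shows "ereal_of_enat (mixing_time \<Omega> P \<pi> e) \<le> ereal b \<longleftrightarrow>
    (\<forall>x\<in>\<Omega>. \<exists>t. real t \<le> b \<and> (\<forall>t'\<ge>t. tv_dist \<Omega> (kernel_power \<Omega> P t' x) \<pi> \<le> e))"
proof -
  define S where "S x = {t. \<forall>t'\<ge>t. tv_dist \<Omega> (kernel_power \<Omega> P t' x) \<pi> \<le> e}" for x
  define \<tau> where "\<tau> x = (INF t\<in>S x. enat t)" for x
  have \<tau>: "ereal_of_enat (\<tau> x) \<le> ereal b \<longleftrightarrow> (\<exists>t\<in>S x. real t \<le> b)" for x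
  proof
    assume le: "ereal_of_enat (\<tau> x) \<le> ereal b"
    have "S x \<noteq> {}"
    proof
      assume "S x = {}"
      then have "\<tau> x = \<infinity>" by (simp add: \<tau>_def top_enat_def)
      with le show False by simp
    qed
    then obtain k where "k \<in> S x" by blast
    then have "enat k \<in> enat ` S x" by (rule imageI)
    then have "\<tau> x \<in> enat ` S x" unfolding \<tau>_def by (rule wellorder_InfI)
    then show "\<exists>t\<in>S x. real t \<le> b" using le by auto
  next
    assume "\<exists>t\<in>S x. real t \<le> b"
    then obtain t where t: "t \<in> S x" "real t \<le> b" by blast
    have "\<tau> x \<le> enat t" unfolding \<tau>_def using t by (intro INF_lower)
    then have "ereal_of_enat (\<tau> x) \<le> ereal_of_enat (enat t)" by (simp only: ereal_of_enat_le_iff)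
    also have "\<dots> \<le> ereal b" using t by simp
    finally show "ereal_of_enat (\<tau> x) \<le> ereal b" .
  qed
  have "ereal_of_enat (mixing_time \<Omega> P \<pi> e) \<le> ereal b \<longleftrightarrow> (\<forall>x\<in>\<Omega>. ereal_of_enat (\<tau> x) \<le> ereal b)"
  proof -
    have mt: "mixing_time \<Omega> P \<pi> e = Max (\<tau> ` \<Omega>)"
      unfolding mixing_time_def \<tau>_def S_def ..
    have "Max (\<tau> ` \<Omega>) \<in> \<tau> ` \<Omega>" using fin by (intro Max_in) auto
    moreover have "ereal_of_enat (\<tau> x) \<le> ereal_of_enat (Max (\<tau> ` \<Omega>))" if "x \<in> \<Omega>" for x
      using that fin by (simp add: ereal_of_enat_le_iff)
    ultimately show ?thesis unfolding mt by (metis imageE order_trans)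
  qed
  then show ?thesis
    unfolding \<tau> by (simp only: S_def Bex_def mem_Collect_eq conj_commute)
qed

text \<open>Rounding the number of steps down to an integer costs at most a factor \<open>exp 1\<close>. The
  deviation bound involves only \<open>sqrt (\<mu> x) \<ge> exp (- H / 2)\<close> and \<open>e\<close> enters as \<open>e / 2\<close>, which absorbs it.\<close>

lemma (in peaked_tree_measure) mixing_time_bound:
  assumes e: "0 < e" "e < 1" and H: "0 \<le> H" and low: "\<And>T. T \<in> cart_trees L \<Longrightarrow> exp (- H) \<le> \<mu> T"
  shows "ereal_of_enat (mixing_time (cart_trees L)
      (lazy (metropolis (cart_trees L) \<mu> (proposal L))) \<mu> e)
    \<le> ereal (2 ^ (2 * L + 3) * (H + ln (2 / e)))"
proof -
  let ?D = "2 ^ (2 * L + 3) :: real" and ?K = "H + ln (2 / e)"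
  let ?P = "lazy (metropolis (cart_trees L) \<mu> (proposal L))"
  interpret contracting_chain "cart_trees L" ?P \<mu> "1 - 1 / ?D" by (rule lazy_chain_contracting)
  have D: "1 \<le> ?D" by simp
  have "0 < ln (2 / e)" using e by simp
  then have K: "0 \<le> ?K" using H by simp
  define t where "t = nat \<lfloor>?D * ?K\<rfloor>"
  have "0 \<le> ?D * ?K" using K by simp
  then have t: "real t \<le> ?D * ?K" "?D * ?K - 1 \<le> real t" unfolding t_def by linarith+
  have dev: "tv_dist (cart_trees L) (kernel_power (cart_trees L) ?P t' x) \<mu> \<le> e"
    if x: "x \<in> cart_trees L" and t': "t \<le> t'" for x t'
  proof -
    have pos: "0 < \<mu> x" using measure_pos[OF x] .
    have "(1 - 1 / ?D) ^ t' \<le> (1 - 1 / ?D) ^ t"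
      using t' D by (intro power_decreasing) auto
    also have "\<dots> \<le> exp (- (1 / ?D)) ^ t"
      using exp_ge_add_one_self[of "- (1 / ?D)"] D by (intro power_mono) auto
    also have "\<dots> = exp (- (real t / ?D))" by (simp add: exp_of_nat_mult[symmetric])
    also have "\<dots> \<le> exp (1 - ?K)"
    proof -
      have "(?D * ?K - 1) / ?D \<le> real t / ?D" using t(2) by (rule divide_right_mono) simp
      then have "?K - 1 / ?D \<le> real t / ?D" by (simp add: diff_divide_distrib)
      moreover have "1 / ?D \<le> 1" using D by simp
      ultimately have "- (real t / ?D) \<le> 1 - ?K" by linarith
      then show ?thesis by simp
    qed
    also have "\<dots> = exp 1 * exp (- H) * (e / 2)"
      using e by (simp add: exp_diff exp_add exp_minus field_simps)
    also have "\<dots> \<le> 4 * exp (- (H / 2)) * (e / 2)"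
    proof -
      have "exp 1 \<le> (4::real)" using exp_le by linarith
      moreover have "exp (- H) \<le> exp (- (H / 2))" using H by simp
      ultimately show ?thesis using e by (intro mult_mono mult_right_mono) auto
    qed
    also have "exp (- (H / 2)) \<le> sqrt (\<mu> x)"
    proof (rule real_le_rsqrt)
      have "(exp (- (H / 2)))\<^sup>2 = exp (- H)" by (simp add: exp_double[symmetric])
      then show "(exp (- (H / 2)))\<^sup>2 \<le> \<mu> x" using low[OF x] by simp
    qed
    finally have "(1 - 1 / ?D) ^ t' \<le> 2 * e * sqrt (\<mu> x)"
      using e by (simp add: mult_ac)
    then have "(1 - 1 / ?D) ^ t' / (2 * sqrt (\<mu> x)) \<le> e"
      using pos by (simp add: field_simps)
    then show ?thesis
      unfolding tv_dist_le_iff[OF finite_cart_trees]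
      using kernel_power_deviation[OF _ x, of _ t'] by (auto intro: order_trans)
  qed
  have "cart_trees L \<noteq> {}" using mode by blast
  then show ?thesis
    using t(1) dev by (subst mixing_time_le_iff) auto
qed

text \<open>Because \<open>\<mu> B \<ge> 1/2\<close>, the normalising constant is at most \<open>2 * prod w B\<close>.\<close>

lemma (in peaked_tree_measure) measure_ge:
  assumes a: "\<And>v. v \<in> nodes L \<Longrightarrow> exp (- a) \<le> w v" "0 \<le> a"
    and b: "\<And>v. v \<in> B \<Longrightarrow> w v \<le> exp b"
    and T: "T \<in> cart_trees L"
  shows "exp (- (ln 2 + 2 ^ L * a + real (card B) * b)) \<le> \<mu> T"
proof -
  let ?Z = "\<Sum>U\<in>cart_trees L. prod w U"
  have "prod w B \<le> (\<Prod>v\<in>B. exp b)"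
    using tree_subset[OF mode] by (intro prod_mono) (auto intro!: b less_imp_le[OF weight_pos])
  then have wB: "prod w B \<le> exp (real (card B) * b)" by (simp add: exp_of_nat_mult)
  have "1 / 2 \<le> prod w B / ?Z" using measure_mode mode by (simp add: tree_measure_def)
  then have "?Z \<le> 2 * prod w B" using total_pos by (simp add: field_simps)
  also have "\<dots> \<le> exp (ln 2) * exp (real (card B) * b)" using wB by simp
  finally have Z: "?Z \<le> exp (ln 2 + real (card B) * b)" by (simp add: exp_add)
  have "(\<Prod>v\<in>T. exp (- a)) \<le> prod w T"
    using tree_subset[OF T] by (intro prod_mono) (auto intro!: a)
  then have wT: "exp (- (real (card T) * a)) \<le> prod w T"
    by (simp add: exp_of_nat_mult[symmetric])
  have "real (card T) \<le> 2 ^ L" using card_tree_le[OF T] by (metis of_nat_le_iff of_nat_numeral of_nat_power)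
  then have "real (card T) * a \<le> 2 ^ L * a" using a(2) by (rule mult_right_mono)
  then have "exp (- (2 ^ L * a)) \<le> exp (- (real (card T) * a))" by simp
  with wT have wT: "exp (- (2 ^ L * a)) \<le> prod w T" by linarith
  have "exp (- (ln 2 + 2 ^ L * a + real (card B) * b))
      = exp (- (2 ^ L * a)) / exp (ln 2 + real (card B) * b)"
    by (simp only: exp_diff[symmetric]) (simp add: algebra_simps)
  also have "\<dots> \<le> prod w T / ?Z"
    using wT Z total_pos less_imp_le[OF prod_weight_pos[OF T]] by (intro frac_le) auto
  finally show ?thesis using T by (simp add: tree_measure_def)
qed

section \<open>The posterior as a product measure\<close>

definition node_weight :: "nat \<Rightarrow> real \<Rightarrow> (nat \<Rightarrow> real) \<Rightarrow> node \<Rightarrow> real" where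
  "node_weight n q Y v =
     q * (1 - q) * (exp ((corr n Y v)\<^sup>2 / (2 * (1 + real n))) / sqrt (1 + real n))"

text \<open>Since \<open>T\<close> has as many external as internal nodes, the prior contributes a factor \<open>q (1 - q)\<close> for each
  internal node.\<close>

lemma posterior_eq:
  assumes n: "n = 2 ^ (M + 1)" and L: "L \<le> M" and q: "0 < q" "q < 1"
  shows "posterior n (\<lambda>_. q) L Y = tree_measure L (node_weight n q Y)"
proof
  fix T
  let ?w = "node_weight n q Y" and ?S = "\<Sum>T\<in>cart_trees L. prior_weight (\<lambda>_. q) T"
  let ?K = "(1 / sqrt (2 * pi)) ^ n * exp (- (\<Sum>i\<in>{1..n}. (Y i)\<^sup>2) / 2)"
  have pw: "prior_weight (\<lambda>_. q) T = (\<Prod>v\<in>T. q * (1 - q))" if "T \<in> cart_trees L" for T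
    using card_ext_nodes[OF that] by (simp add: prior_weight_def power_mult_distrib)
  have S: "0 < ?S"
  proof (rule sum_pos)
    show "cart_trees L \<noteq> {}" using null_tree_in by blast
    show "0 < prior_weight (\<lambda>_. q) T" if "T \<in> cart_trees L" for T
      unfolding pw[OF that] using q by (intro prod_pos) simp
  qed simp
  have K: "0 < ?K" by simp
  have joint: "prior (\<lambda>_. q) L T * marginal_likelihood n Y T = ?K / ?S * prod ?w T"
    if T: "T \<in> cart_trees L" for T
  proof -
    have sub: "T \<subseteq> nodes M" using tree_subset[OF T] nodes_mono[OF L] by blast
    have "prod ?w T = (\<Prod>v\<in>T. q * (1 - q))
        * (\<Prod>v\<in>T. exp ((corr n Y v)\<^sup>2 / (2 * (1 + real n))) / sqrt (1 + real n))"
      unfolding node_weight_def by (rule prod.distrib)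
    then show ?thesis
      unfolding marginal_likelihood_eq[OF n sub] prior_def pw[OF T] using T by simp
  qed
  show "posterior n (\<lambda>_. q) L Y T = tree_measure L ?w T"
  proof (cases "T \<in> cart_trees L")
    case True
    have total: "(\<Sum>U\<in>cart_trees L. prior (\<lambda>_. q) L U * marginal_likelihood n Y U)
        = ?K / ?S * (\<Sum>U\<in>cart_trees L. prod ?w U)"
      unfolding sum_distrib_left by (intro sum.cong refl joint)
    have nz: "?K / ?S \<noteq> 0" using S K by simp
    show ?thesis
      unfolding posterior_def tree_measure_def joint[OF True] total
      using True by (simp only: mult_divide_mult_cancel_left[OF nz] if_True)
  next
    case False
    then show ?thesis by (simp add: posterior_def prior_def tree_measure_def)
  qed
qed

lemma cart_kernel_eq:
  "cart_kernel n p L Y = lazy (metropolis (cart_trees L) (posterior n p L Y) (proposal L))"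
  by (intro ext) (simp add: cart_kernel_def lazy_def mh_kernel_def metropolis_def acceptance_def)

section \<open>Measurability of the mixing time in the data\<close>

lemma measurable_kernel_power:
  assumes [measurable]: "\<And>x y. (\<lambda>Y. P Y x y) \<in> borel_measurable M"
  shows "(\<lambda>Y. kernel_power \<Omega> (P Y) t x y) \<in> borel_measurable M"
proof (induction t arbitrary: x)
  case (Suc t)
  note Suc[measurable]
  show ?case by simp
qed simp

lemma measurable_corr:
  "(\<lambda>Y. corr n Y v) \<in> borel_measurable (\<Pi>\<^sub>M i\<in>{1..n}. borel)"
  unfolding corr_def by measurable

lemma measurable_tree_measure:
  "(\<lambda>Y. tree_measure L (node_weight n q Y) T) \<in> borel_measurable (\<Pi>\<^sub>M i\<in>{1..n}. borel)"
  unfolding tree_measure_def node_weight_def using measurable_corr[measurable] by measurable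

lemma measurable_lazy_metropolis:
  assumes [measurable]: "\<And>x. (\<lambda>Y. \<pi> Y x) \<in> borel_measurable M"
  shows "(\<lambda>Y. lazy (metropolis \<Omega> (\<pi> Y) S) x y) \<in> borel_measurable M"
  unfolding lazy_def metropolis_def by measurable

lemma mixing_time_event_measurable:
  fixes e b :: real
  assumes \<pi>: "\<And>x. (\<lambda>Y. \<pi> Y x) \<in> borel_measurable M" and fin: "finite \<Omega>" "\<Omega> \<noteq> {}"
  shows "{Y \<in> space M. ereal_of_enat (mixing_time \<Omega> (lazy (metropolis \<Omega> (\<pi> Y) S)) (\<pi> Y) e) \<le> ereal b}
    \<in> sets M"
proof -
  let ?P = "\<lambda>Y. lazy (metropolis \<Omega> (\<pi> Y) S)"
  note \<pi>[measurable]
  have [measurable]: "(\<lambda>Y. kernel_power \<Omega> (?P Y) t x y) \<in> borel_measurable M" for t x y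
    by (intro measurable_kernel_power measurable_lazy_metropolis \<pi>)
  have "countable (Pow \<Omega>)" using fin by (simp add: countable_finite)
  moreover have "countable \<Omega>" using fin by (simp add: countable_finite)
  ultimately have "{Y \<in> space M. \<forall>x\<in>\<Omega>. \<exists>t. real t \<le> b \<and> (\<forall>t'. t \<le> t' \<longrightarrow>
      (\<forall>E\<in>Pow \<Omega>. \<bar>sum (kernel_power \<Omega> (?P Y) t' x) E - sum (\<pi> Y) E\<bar> \<le> e))} \<in> sets M"
    by measurable
  then show ?thesis
    by (simp only: mixing_time_le_iff[OF fin] tv_dist_le_iff[OF fin(1)])
qed

section \<open>The typical event\<close>

definition small_noise :: "nat \<Rightarrow> nat \<Rightarrow> (nat \<Rightarrow> real) \<Rightarrow> bool" where
  "small_noise n L e \<longleftrightarrow> (\<forall>v\<in>nodes L. \<bar>corr n e v\<bar> \<le> 2 * sqrt (real n * ln (real n)))"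

text \<open>There are at most \<open>n / 2\<close> nodes, and each one-sided tail at \<open>2 sqrt (n ln n)\<close> has probability at most \<open>n ^ (-2)\<close>.\<close>

lemma small_noise_prob:
  assumes n: "n = 2 ^ (M + 1)" and L: "L \<le> M"
  shows "measure (\<Pi>\<^sub>M i\<in>{1..n}. std_normal)
      {e \<in> space (\<Pi>\<^sub>M i\<in>{1..n}. std_normal). small_noise n L e} \<ge> 1 - 1 / real n"
    and "{e \<in> space (\<Pi>\<^sub>M i\<in>{1..n}. std_normal). small_noise n L e} \<in> sets (\<Pi>\<^sub>M i\<in>{1..n}. std_normal)"
proof -
  let ?M = "\<Pi>\<^sub>M i\<in>{1..n}. std_normal"
  let ?t = "2 * sqrt (real n * ln (real n))"
  interpret prob_space ?M by (intro prob_space_PiM std_normal.prob_space_axioms)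
  have n2: "2 \<le> n" using n by simp
  then have lnn: "0 < ln (real n)" by simp
  have t: "0 < ?t" using n2 lnn by simp
  have [measurable]: "(\<lambda>e. corr n e v) \<in> borel_measurable ?M" for v
    unfolding corr_def by measurable
  show meas: "{e \<in> space ?M. small_noise n L e} \<in> sets ?M"
  proof -
    have "countable (nodes L)" by (simp add: countable_finite)
    then show ?thesis unfolding small_noise_def by measurable
  qed
  define hi where "hi v = {e \<in> space ?M. ?t \<le> (\<Sum>i\<in>{1..n}. design n i v * e i)}" for v
  define lo where "lo v = {e \<in> space ?M. ?t \<le> (\<Sum>i\<in>{1..n}. - design n i v * e i)}" for v
  have [measurable]: "hi v \<in> sets ?M" "lo v \<in> sets ?M" for v
    unfolding hi_def lo_def by measurable
  have hi_lo: "hi v \<union> lo v \<in> sets ?M" for v by measurable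
  have tail: "exp (- ?t\<^sup>2 / (2 * real n)) = 1 / (real n)\<^sup>2"
  proof -
    have "- ?t\<^sup>2 / (2 * real n) = - (2 * ln (real n))"
      using n2 lnn by (simp add: power_mult_distrib)
    also have "exp \<dots> = 1 / (real n)\<^sup>2"
      using n2 by (simp add: exp_minus exp_double inverse_eq_divide)
    finally show ?thesis .
  qed
  have bound: "measure ?M (hi v \<union> lo v) \<le> 2 / (real n)\<^sup>2" if v: "v \<in> nodes L" for v
  proof -
    have "v \<in> nodes M" using v nodes_mono[OF L] by blast
    then have sq: "(\<Sum>i\<in>{1..n}. (design n i v)\<^sup>2) = real n"
      using design_orthogonal[OF n, of v v] by (simp add: power2_eq_square)
    have "measure ?M (hi v) \<le> exp (- ?t\<^sup>2 / (2 * real n))"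
      unfolding hi_def using t sq n2 by (intro gaussian_linear_tail) auto
    moreover have "measure ?M (lo v) \<le> exp (- ?t\<^sup>2 / (2 * real n))"
      unfolding lo_def using t sq n2 by (intro gaussian_linear_tail) auto
    moreover have "measure ?M (hi v \<union> lo v) \<le> measure ?M (hi v) + measure ?M (lo v)"
      by (intro measure_Un_le) measurable
    ultimately show ?thesis unfolding tail by simp
  qed
  have "measure ?M (\<Union>v\<in>nodes L. hi v \<union> lo v) \<le> (\<Sum>v\<in>nodes L. measure ?M (hi v \<union> lo v))"
    by (rule finite_measure_subadditive_finite) (use hi_lo in \<open>blast intro: finite_nodes\<close>)+
  also have "\<dots> \<le> (\<Sum>v\<in>nodes L. 2 / (real n)\<^sup>2)" by (intro sum_mono bound)
  also have "\<dots> = (2 * 2 ^ L) / (real n)\<^sup>2" by (simp add: card_nodes)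
  also have "\<dots> \<le> real n / (real n)\<^sup>2"
    using L n by (intro divide_right_mono) (auto simp: power_increasing)
  also have "\<dots> = 1 / real n" by (simp add: power2_eq_square)
  finally have bad: "measure ?M (\<Union>v\<in>nodes L. hi v \<union> lo v) \<le> 1 / real n" .
  have "space ?M - (\<Union>v\<in>nodes L. hi v \<union> lo v) \<subseteq> {e \<in> space ?M. small_noise n L e}"
  proof
    fix e assume e: "e \<in> space ?M - (\<Union>v\<in>nodes L. hi v \<union> lo v)"
    have "\<bar>corr n e v\<bar> \<le> ?t" if "v \<in> nodes L" for v
      using e that by (auto simp: hi_def lo_def corr_def sum_negf)
    then show "e \<in> {e \<in> space ?M. small_noise n L e}" using e by (simp add: small_noise_def)
  qed
  then have "measure ?M (space ?M - (\<Union>v\<in>nodes L. hi v \<union> lo v))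
      \<le> measure ?M {e \<in> space ?M. small_noise n L e}"
    using meas by (intro finite_measure_mono)
  moreover have "measure ?M (space ?M - (\<Union>v\<in>nodes L. hi v \<union> lo v))
      = 1 - measure ?M (\<Union>v\<in>nodes L. hi v \<union> lo v)"
    by (intro prob_compl sets.finite_UN hi_lo finite_nodes)
  ultimately show "1 - 1 / real n \<le> measure ?M {e \<in> space ?M. small_noise n L e}"
    using bad by linarith
qed

lemma corr_signal:
  assumes n: "n = 2 ^ (M + 1)" and B: "B \<subseteq> nodes M" and v: "v \<in> nodes M"
    and f0: "\<And>x. x \<in> {0..1} \<Longrightarrow> f0 x = (\<Sum>u\<in>B. \<beta> u * haar u x)"
  shows "corr n (\<lambda>i\<in>{1..n}. f0 (grid n i) + e i) v = (if v \<in> B then real n * \<beta> v else 0) + corr n e v"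
proof -
  have fin: "finite B" using B finite_nodes finite_subset by blast
  have f0_grid: "f0 (grid n i) = (\<Sum>u\<in>B. \<beta> u * design n i u)" if "i \<in> {1..n}" for i
    using that by (subst f0) (auto simp: grid_def design_def)
  have "corr n (\<lambda>i\<in>{1..n}. f0 (grid n i) + e i) v
      = (\<Sum>i\<in>{1..n}. design n i v * (\<Sum>u\<in>B. \<beta> u * design n i u)) + corr n e v"
    unfolding corr_def sum.distrib[symmetric]
    by (intro sum.cong refl) (simp add: f0_grid algebra_simps)
  also have "(\<Sum>i\<in>{1..n}. design n i v * (\<Sum>u\<in>B. \<beta> u * design n i u))
      = (\<Sum>u\<in>B. \<beta> u * (\<Sum>i\<in>{1..n}. design n i v * design n i u))"
    unfolding sum_distrib_left by (subst sum.swap) (simp add: mult_ac)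
  also have "\<dots> = (\<Sum>u\<in>B. if v = u then real n * \<beta> u else 0)"
    using B by (intro sum.cong refl, subst design_orthogonal[OF n v]) auto
  also have "\<dots> = (if v \<in> B then real n * \<beta> v else 0)"
    using fin by simp
  finally show ?thesis .
qed

section \<open>Node weights on the typical event\<close>

lemma small_inclusion_prob:
  assumes c: "5/2 < (c::real)" and n: "8 \<le> (n::nat)"
  shows "0 < real n powr (- c)" "real n powr (- c) \<le> 1 / 2"
proof -
  have n1: "1 < real n" using n by simp
  show "0 < real n powr (- c)" using n1 by simp
  have "real n powr (- c) \<le> real n powr (- 1)" using n1 c by (intro powr_mono) auto
  also have "\<dots> = 1 / real n" using n1 by (simp add: powr_minus_divide)
  also have "\<dots> \<le> 1 / 2" using n by (simp add: field_simps)
  finally show "real n powr (- c) \<le> 1 / 2" .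
qed

text \<open>The noise contributes at most \<open>n powr 2\<close> and the normalisation \<open>n powr (-1/2)\<close>; the exponent
  \<open>- c + 2 - 1/2\<close> is below \<open>-1\<close> exactly when \<open>c > 5/2\<close>.\<close>

lemma noise_weight_le:
  assumes c: "5/2 < c" and n: "8 \<le> n" and s: "\<bar>corr n Y v\<bar> \<le> 2 * sqrt (real n * ln (real n))"
  shows "node_weight n (real n powr (- c)) Y v \<le> 1 / real n"
proof -
  let ?q = "real n powr (- c)"
  have n1: "1 < real n" using n by simp
  have lnn: "0 < ln (real n)" using n1 by simp
  note q = small_inclusion_prob[OF c n]
  have "(corr n Y v)\<^sup>2 \<le> (2 * sqrt (real n * ln (real n)))\<^sup>2"
    using s by (intro abs_le_square_iff[THEN iffD1]) (use n1 lnn in simp)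
  also have "\<dots> = 4 * real n * ln (real n)" using n1 lnn by (simp add: power_mult_distrib)
  also have "\<dots> \<le> (2 * ln (real n)) * (2 * (1 + real n))" using lnn by (simp add: algebra_simps)
  finally have "(corr n Y v)\<^sup>2 / (2 * (1 + real n)) \<le> 2 * ln (real n)"
    by (subst pos_divide_le_eq) auto
  then have "exp ((corr n Y v)\<^sup>2 / (2 * (1 + real n))) \<le> exp (2 * ln (real n))" by simp
  also have "\<dots> = real n powr 2" using n1 by (simp add: powr_def)
  finally have ex: "exp ((corr n Y v)\<^sup>2 / (2 * (1 + real n))) \<le> real n powr 2" .
  have sq: "real n powr (1/2) \<le> sqrt (1 + real n)" using n1 by (simp add: powr_half_sqrt)
  have "node_weight n ?q Y v \<le> ?q * 1 * (real n powr 2 / real n powr (1/2))"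
    unfolding node_weight_def using q ex sq n1
    by (intro mult_mono frac_le) (auto simp del: powr_numeral)
  also have "\<dots> = real n powr (- c + (2 - 1/2))"
    by (simp only: powr_add powr_diff mult_1_right)
  also have "\<dots> \<le> real n powr (- 1)" using n1 c by (intro powr_mono) auto
  also have "\<dots> = 1 / real n" using n1 by (simp add: powr_minus_divide)
  finally show ?thesis .
qed

text \<open>As \<open>ln n \<ge> 1\<close>, the noise is at most \<open>2 sqrt n * ln n\<close>, hence the correlation is at least \<open>(A - 2) sqrt n * ln n\<close> in
  absolute value. With \<open>A \<ge> c + 6\<close> its exponential is at least \<open>n powr (c + 3)\<close>, and this outweighs the prior factor
  \<open>n powr (- c)\<close> and the normalisation.\<close>

lemma signal_weight_ge:
  assumes c: "5/2 < c" and n: "8 \<le> n" and A: "c + 6 \<le> A"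
    and b: "A * ln (real n) / sqrt (real n) \<le> \<bar>b\<bar>"
    and s: "\<bar>z\<bar> \<le> 2 * sqrt (real n * ln (real n))" "corr n Y v = real n * b + z"
  shows "real n \<le> node_weight n (real n powr (- c)) Y v"
proof -
  let ?q = "real n powr (- c)" and ?l = "ln (real n)"
  have n1: "1 < real n" using n by simp
  have l1: "1 \<le> ?l"
  proof -
    have "exp 1 \<le> real n" using exp_le n by simp
    then have "ln (exp 1) \<le> ?l" using n1 by (subst ln_le_cancel_iff) auto
    then show ?thesis by simp
  qed
  note q = small_inclusion_prob[OF c n]
  have "real n * (A * ?l / sqrt (real n)) \<le> real n * \<bar>b\<bar>" using b by (intro mult_left_mono) auto
  moreover have "real n * (A * ?l / sqrt (real n)) = sqrt (real n) * ?l * A"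
    using n1 by (simp add: real_div_sqrt field_simps)
  moreover have "2 * sqrt (real n * ?l) \<le> 2 * (sqrt (real n) * ?l)"
  proof -
    have "sqrt ?l \<le> ?l" using l1 by (intro real_le_lsqrt) (auto simp: power2_eq_square)
    then show ?thesis by (simp add: real_sqrt_mult mult_left_mono)
  qed
  moreover have "real n * \<bar>b\<bar> - \<bar>z\<bar> \<le> \<bar>corr n Y v\<bar>" unfolding s(2) by (simp add: abs_mult abs_triangle_ineq4)
  ultimately have "sqrt (real n) * ?l * (A - 2) \<le> \<bar>corr n Y v\<bar>"
    using s(1) by (simp add: algebra_simps)
  moreover have "sqrt (real n) * ?l * (c + 4) \<le> sqrt (real n) * ?l * (A - 2)"
    using A l1 by (intro mult_left_mono) auto
  ultimately have "sqrt (real n) * ?l * (c + 4) \<le> \<bar>corr n Y v\<bar>" by linarith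
  then have "(sqrt (real n) * ?l * (c + 4))\<^sup>2 \<le> \<bar>corr n Y v\<bar>\<^sup>2"
    using l1 c by (intro power_mono) auto
  then have sq: "real n * ?l\<^sup>2 * (c + 4)\<^sup>2 \<le> (corr n Y v)\<^sup>2"
    by (simp add: power_mult_distrib)
  have "?l * (c + 3) * (2 * (1 + real n)) \<le> ?l * (c + 3) * (4 * real n)"
    using n1 l1 c by (intro mult_left_mono) auto
  also have "\<dots> = real n * ?l * (4 * (c + 3))" by simp
  also have "\<dots> \<le> real n * ?l\<^sup>2 * (c + 4)\<^sup>2"
  proof (intro mult_mono)
    show "?l \<le> ?l\<^sup>2" using l1 by (simp add: power2_eq_square)
    have "0 \<le> c\<^sup>2" by simp
    then show "4 * (c + 3) \<le> (c + 4)\<^sup>2" using c by (simp add: power2_sum)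
  qed (use c l1 in auto)
  finally have "?l * (c + 3) \<le> (corr n Y v)\<^sup>2 / (2 * (1 + real n))"
    using sq by (subst pos_le_divide_eq) auto
  then have "exp (?l * (c + 3)) \<le> exp ((corr n Y v)\<^sup>2 / (2 * (1 + real n)))" by simp
  then have ex: "real n powr (c + 3) \<le> exp ((corr n Y v)\<^sup>2 / (2 * (1 + real n)))"
    using n1 by (simp add: powr_def mult.commute)
  have root: "sqrt (1 + real n) \<le> real n / 2"
  proof (rule real_le_lsqrt)
    have "8 * real n \<le> real n * real n" using n by (intro mult_right_mono) auto
    moreover have "(real n / 2)\<^sup>2 = real n * real n / 4" by (simp add: power2_eq_square)
    moreover have "8 \<le> real n" using n by simp
    ultimately show "1 + real n \<le> (real n / 2)\<^sup>2" by linarith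
  qed (use n1 in auto)
  have "real n = real n powr (- c) * (1 / 2) * (real n powr (c + 1) / (real n / 2)) * real n"
    using n1 by (simp add: powr_add powr_minus)
  also have "\<dots> \<le> real n powr (- c) * (1 / 2) * (real n powr (c + 1) / (real n / 2)) * (real n powr 2)"
    using n1 by (intro mult_left_mono) (auto simp: power2_eq_square)
  also have "\<dots> = real n powr (- c) * (1 / 2) * (real n powr (c + 3) / (real n / 2))"
  proof -
    have "c + 3 = (c + 1) + 2" by simp
    then have "real n powr (c + 3) = real n powr (c + 1) * real n powr 2" by (simp only: powr_add)
    then show ?thesis by simp
  qed
  also have "\<dots> \<le> node_weight n ?q Y v"
    unfolding node_weight_def using q ex root n1
    by (intro mult_mono frac_le) auto
  finally show ?thesis .
qed

lemma node_weight_ge: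
  assumes c: "5/2 < c" and n: "8 \<le> n"
  shows "exp (- ((c + 1/2) * ln (1 + real n) + ln 2)) \<le> node_weight n (real n powr (- c)) Y v"
proof -
  let ?q = "real n powr (- c)"
  have n1: "1 < real n" using n by simp
  note q = small_inclusion_prob[OF c n]
  have "exp (- ((c + 1/2) * ln (1 + real n) + ln 2)) = (1 + real n) powr (- c) * (1 / 2) * (1 / sqrt (1 + real n))"
  proof -
    have "- ((c + 1/2) * ln (1 + real n) + ln 2)
        = (- c) * ln (1 + real n) + (- ln 2) + (- (1/2 * ln (1 + real n)))"
      by (simp add: algebra_simps)
    moreover have "exp (1/2 * ln (1 + real n)) = sqrt (1 + real n)"
      by (simp add: powr_half_sqrt[symmetric] powr_def)
    ultimately show ?thesis
      by (simp only: exp_add exp_minus) (simp add: powr_def inverse_eq_divide)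
  qed
  also have "\<dots> \<le> ?q * (1 - ?q) * (exp ((corr n Y v)\<^sup>2 / (2 * (1 + real n))) / sqrt (1 + real n))"
  proof (intro mult_mono divide_right_mono)
    show "(1 + real n) powr (- c) \<le> ?q" using n1 c by (intro powr_mono2') auto
  qed (use q in auto)
  finally show ?thesis by (simp add: node_weight_def)
qed

text \<open>From \<open>(n b + z)\<^sup>2 \<le> 2 (n b)\<^sup>2 + 2 z\<^sup>2\<close>. Up to the number of signal nodes, the two terms on the right are those that appear in the mixing
  time bound.\<close>

lemma signal_weight_le:
  assumes c: "5/2 < c" and n: "8 \<le> n" and b: "\<bar>b\<bar> < C"
    and s: "\<bar>z\<bar> \<le> 2 * sqrt (real n * ln (real n))" "corr n Y v = real n * b + z"
  shows "node_weight n (real n powr (- c)) Y v \<le> exp (real n * C\<^sup>2 + 4 * ln (real n))"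
proof -
  let ?q = "real n powr (- c)" and ?l = "ln (real n)"
  have n1: "1 < real n" using n by simp
  have l0: "0 < ?l" using n1 by simp
  note q = small_inclusion_prob[OF c n]
  have "z\<^sup>2 \<le> (2 * sqrt (real n * ?l))\<^sup>2"
    using s(1) by (intro abs_le_square_iff[THEN iffD1]) (use n1 l0 in simp)
  then have z: "z\<^sup>2 \<le> 4 * (real n * ?l)" using n1 l0 by (simp add: power_mult_distrib)
  have bC: "b\<^sup>2 \<le> C\<^sup>2" using b by (intro abs_le_square_iff[THEN iffD1]) auto
  have "(corr n Y v)\<^sup>2 \<le> 2 * (real n * b)\<^sup>2 + 2 * z\<^sup>2"
    unfolding s(2) using zero_le_power2[of "real n * b - z"] by (simp add: power2_eq_square algebra_simps)
  also have "\<dots> \<le> 2 * ((real n)\<^sup>2 * C\<^sup>2) + 2 * (4 * (real n * ?l))"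
    using z bC by (intro add_mono mult_left_mono) (auto simp: power_mult_distrib intro: mult_left_mono)
  also have "\<dots> \<le> (real n * C\<^sup>2 + 4 * ?l) * (2 * (1 + real n))"
  proof -
    have "(real n * C\<^sup>2 + 4 * ?l) * (2 * (1 + real n))
        = 2 * ((real n)\<^sup>2 * C\<^sup>2) + 2 * (4 * (real n * ?l)) + (2 * (real n * C\<^sup>2) + 8 * ?l)"
      by (simp add: power2_eq_square algebra_simps)
    moreover have "0 \<le> real n * C\<^sup>2" by simp
    ultimately show ?thesis using l0 by linarith
  qed
  finally have "(corr n Y v)\<^sup>2 / (2 * (1 + real n)) \<le> real n * C\<^sup>2 + 4 * ?l"
    by (subst pos_divide_le_eq) auto
  then have ex: "exp ((corr n Y v)\<^sup>2 / (2 * (1 + real n))) \<le> exp (real n * C\<^sup>2 + 4 * ?l)" by simp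
  have "node_weight n ?q Y v \<le> 1 * 1 * (exp (real n * C\<^sup>2 + 4 * ?l) / 1)"
    unfolding node_weight_def using q ex by (intro mult_mono frac_le) auto
  then show ?thesis by simp
qed

section \<open>The mixing time bound\<close>

lemma mixing_time_small_noise:
  fixes c A C \<epsilon> :: real
  assumes c: "5/2 < c" and A: "c + 6 \<le> A"
    and n: "n = 2 ^ (M + 1)" "8 \<le> n" and L: "L \<le> M"
    and F: "assumption_F A C n L f0 B \<beta>" and B: "B \<in> cart_trees L"
    and \<epsilon>: "0 < \<epsilon>" "\<epsilon> < 1"
    and e: "small_noise n L e"
  defines "Y \<equiv> \<lambda>i\<in>{1..n}. f0 (grid n i) + e i"
  shows "ereal_of_enat (cart_mixing_time n (\<lambda>_. real n powr (- c)) L Y \<epsilon>)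
           \<le> ereal (2 ^ (2 * L + 3) *
               (real n * ((c + 1/2) * ln (1 + real n) + real (card B) * C\<^sup>2 + 1)
                + 4 * real (card B) * ln (real n) + ln (2 / \<epsilon>)))"
proof -
  let ?q = "real n powr (- c)"
  let ?w = "node_weight n ?q Y" and ?l = "ln (real n)"
  have n1: "1 < real n" using n(2) by simp
  have l0: "0 < ?l" using n1 by simp
  have pow: "2 * 2 ^ L \<le> real n"
    using power_increasing[OF L, of "2::real"] n(1) by simp
  have sub: "nodes L \<subseteq> nodes M" by (rule nodes_mono[OF L])
  have BM: "B \<subseteq> nodes M" using tree_subset[OF B] sub by blast
  have f0: "f0 x = (\<Sum>u\<in>B. \<beta> u * haar u x)" if "x \<in> {0..1}" for x
    using F that by (simp add: assumption_F_def)
  have coef: "A * ?l / sqrt (real n) < \<bar>\<beta> v\<bar>" "\<bar>\<beta> v\<bar> < C" if "v \<in> B" for v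
    using F that by (simp_all add: assumption_F_def)
  have corr_Y: "corr n Y v = (if v \<in> B then real n * \<beta> v else 0) + corr n e v" if "v \<in> nodes L" for v
    unfolding Y_def using sub that by (intro corr_signal[OF n(1) BM _ f0]) auto
  have noise: "\<bar>corr n e v\<bar> \<le> 2 * sqrt (real n * ?l)" if "v \<in> nodes L" for v
    using e that by (simp add: small_noise_def)
  interpret peaked_tree_measure L ?w B "1 / real n"
  proof
    show "0 < ?w v" for v
      using node_weight_ge[OF c n(2), of Y v] by (rule less_le_trans[OF exp_gt_zero])
    show "?w v \<le> 1 / real n" if "v \<in> nodes L" "v \<notin> B" for v
      using corr_Y[OF that(1)] noise[OF that(1)] that(2) by (intro noise_weight_le[OF c n(2)]) simp
    show "1 \<le> 1 / real n * ?w v" if v: "v \<in> B" for v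
    proof -
      have vL: "v \<in> nodes L" using v tree_subset[OF B] by blast
      have "real n \<le> ?w v"
        using signal_weight_ge[OF c n(2) A less_imp_le[OF coef(1)[OF v]] noise[OF vL]] corr_Y[OF vL] v
        by simp
      then show ?thesis using n1 by (simp add: field_simps)
    qed
    show "1 / real n * 2 ^ L \<le> 1 / 2" using pow n1 by (simp add: field_simps)
  qed (use B n1 in auto)
  let ?a = "(c + 1/2) * ln (1 + real n) + ln 2" and ?b = "real n * C\<^sup>2 + 4 * ?l"
  let ?H = "real n * ((c + 1/2) * ln (1 + real n) + real (card B) * C\<^sup>2 + 1) + 4 * real (card B) * ?l"
  have x0: "0 \<le> (c + 1/2) * ln (1 + real n)" using c n1 by simp
  \<comment> \<open>As \<open>2 ^ L \<le> n / 2\<close>, the terms with \<open>ln 2\<close> fit into the summand \<open>n * 1\<close> of the bound.\<close>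
  have H: "ln 2 + 2 ^ L * ?a + real (card B) * ?b \<le> ?H"
  proof -
    have "2 ^ L * ?a \<le> real n / 2 * ?a" using pow x0 by (intro mult_right_mono) auto
    moreover have "real n / 2 * ?a \<le> real n / 2 * ((c + 1/2) * ln (1 + real n) + 1)"
      using ln_2_less_1 by (intro mult_left_mono) auto
    moreover have "real n / 2 * ((c + 1/2) * ln (1 + real n)) \<le> real n * ((c + 1/2) * ln (1 + real n))"
      using x0 by (intro mult_right_mono) auto
    moreover have "ln (2::real) + real n / 2 \<le> real n" using ln_2_less_1 n(2) by simp
    ultimately show ?thesis by (simp add: algebra_simps)
  qed
  have "0 \<le> ?H" using c l0 n1 by (intro add_nonneg_nonneg mult_nonneg_nonneg) auto
  moreover have "exp (- ?H) \<le> \<mu> T" if T: "T \<in> cart_trees L" for T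
  proof -
    have "exp (- (ln 2 + 2 ^ L * ?a + real (card B) * ?b)) \<le> \<mu> T"
    proof (rule measure_ge[OF _ _ _ T])
      show "exp (- ?a) \<le> ?w v" for v by (rule node_weight_ge[OF c n(2)])
      show "?w v \<le> exp ?b" if v: "v \<in> B" for v
      proof -
        have vL: "v \<in> nodes L" using v tree_subset[OF B] by blast
        show ?thesis
          using signal_weight_le[OF c n(2) coef(2)[OF v] noise[OF vL]] corr_Y[OF vL] v by simp
      qed
      show "0 \<le> ?a" using x0 by simp
    qed
    moreover have "exp (- ?H) \<le> exp (- (ln 2 + 2 ^ L * ?a + real (card B) * ?b))" using H by simp
    ultimately show ?thesis by linarith
  qed
  ultimately have "ereal_of_enat (mixing_time (cart_trees L)
      (lazy (metropolis (cart_trees L) \<mu> (proposal L))) \<mu> \<epsilon>)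
    \<le> ereal (2 ^ (2 * L + 3) * (?H + ln (2 / \<epsilon>)))"
    by (intro mixing_time_bound \<epsilon>)
  moreover have "?q < 1" using small_inclusion_prob[OF c n(2)] by linarith
  ultimately show ?thesis
    unfolding cart_mixing_time_def cart_kernel_eq
    using posterior_eq[OF n(1) L, of ?q Y] small_inclusion_prob[OF c n(2)] by simp
qed

theorem theorem3:
  fixes c :: real
  assumes "c > 5/2"
  shows "\<exists>A0>0. \<forall>A\<ge>A0. \<forall>C>0. \<forall>(Lmax::nat) (L::nat) (n::nat) (f0::real \<Rightarrow> real) (B::node set)
           (\<beta>::node \<Rightarrow> real) (\<epsilon>::real).
      n = 2 ^ (Lmax + 1) \<longrightarrow> L \<le> Lmax \<longrightarrow>
      assumption_F A C n L f0 B \<beta> \<longrightarrow> B \<in> cart_trees L \<longrightarrow> 0 < \<epsilon> \<longrightarrow> \<epsilon> < 1 \<longrightarrow>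
      measure (data_law n f0)
        {Y \<in> space (data_law n f0).
           ereal_of_enat (cart_mixing_time n (\<lambda>_. real n powr (- c)) L Y \<epsilon>)
           \<le> ereal (2 ^ (2 * L + 3) *
               (real n * ((c + 1/2) * ln (1 + real n) + real (card (smallest_tree L B)) * C\<^sup>2 + 1)
                + 4 * real (card (smallest_tree L B)) * ln (real n) + ln (2 / \<epsilon>)))}
      \<ge> 1 - 4 / real n"
proof (intro exI[of _ "c + 6"] conjI allI impI)
  show "0 < c + 6" using assms by simp
  fix A C :: real and Lmax L n :: nat and f0 :: "real \<Rightarrow> real" and B :: "node set"
    and \<beta> :: "node \<Rightarrow> real" and \<epsilon> :: real
  assume A: "c + 6 \<le> A" and n: "n = 2 ^ (Lmax + 1)" and L: "L \<le> Lmax"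
    and F: "assumption_F A C n L f0 B \<beta>" and B: "B \<in> cart_trees L" and \<epsilon>: "0 < \<epsilon>" "\<epsilon> < 1"
  let ?q = "real n powr (- c)"
  let ?b = "2 ^ (2 * L + 3) *
               (real n * ((c + 1/2) * ln (1 + real n) + real (card (smallest_tree L B)) * C\<^sup>2 + 1)
                + 4 * real (card (smallest_tree L B)) * ln (real n) + ln (2 / \<epsilon>))"
  let ?E = "{Y \<in> space (data_law n f0).
      ereal_of_enat (cart_mixing_time n (\<lambda>_. ?q) L Y \<epsilon>) \<le> ereal ?b}"
  let ?N = "\<Pi>\<^sub>M i\<in>{1..n}. std_normal" and ?shift = "\<lambda>e. \<lambda>i\<in>{1..n}. f0 (grid n i) + e i"
  show "1 - 4 / real n \<le> measure (data_law n f0) ?E"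
  proof (cases "Lmax < 2")
    \<comment> \<open>For \<open>n \<le> 4\<close> the claimed probability is not positive; the estimates of the node weights hold for \<open>n \<ge> 8\<close>.\<close>
    case True
    then have "Lmax = 0 \<or> Lmax = 1" by auto
    then have "n \<le> 4" using n by auto
    moreover have "0 < real n" using n by simp
    ultimately have "1 - 4 / real n \<le> 0" by (simp add: field_simps)
    also have "\<dots> \<le> measure (data_law n f0) ?E" by simp
    finally show ?thesis .
  next
    case False
    then have n8: "8 \<le> n" using n power_increasing[of 3 "Lmax + 1" "2::nat"] by simp
    have q: "0 < ?q" "?q < 1" using small_inclusion_prob[OF assms n8] by linarith+
    have shift: "?shift \<in> measurable ?N (\<Pi>\<^sub>M i\<in>{1..n}. borel)" by measurable
    have space_law: "space (data_law n f0) = space (\<Pi>\<^sub>M i\<in>{1..n}. borel)"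
      by (simp add: data_law_def)
    have E: "?E \<in> sets (\<Pi>\<^sub>M i\<in>{1..n}. borel)"
      unfolding space_law cart_mixing_time_def cart_kernel_eq posterior_eq[OF n L q]
      using B by (intro mixing_time_event_measurable measurable_tree_measure) auto
    interpret prob_space ?N by (intro prob_space_PiM std_normal.prob_space_axioms)
    have law: "measure (data_law n f0) X = measure ?N (?shift -` X \<inter> space ?N)"
      if "X \<in> sets (\<Pi>\<^sub>M i\<in>{1..n}. borel)" for X
      unfolding data_law_def by (rule measure_distr[OF shift that])
    have "measure ?N {e \<in> space ?N. small_noise n L e} \<le> measure ?N (?shift -` ?E \<inter> space ?N)"
    proof (rule finite_measure_mono)
      show "?shift -` ?E \<inter> space ?N \<in> sets ?N" using shift E by (rule measurable_sets)
      show "{e \<in> space ?N. small_noise n L e} \<subseteq> ?shift -` ?E \<inter> space ?N"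
      proof
        fix e assume "e \<in> {e \<in> space ?N. small_noise n L e}"
        then have e: "e \<in> space ?N" "small_noise n L e" by blast+
        show "e \<in> ?shift -` ?E \<inter> space ?N"
        proof (intro IntI vimageI2 CollectI conjI)
          show "?shift e \<in> space (data_law n f0)"
            unfolding space_law by (rule measurable_space[OF shift e(1)])
          show "ereal_of_enat (cart_mixing_time n (\<lambda>_. ?q) L (?shift e) \<epsilon>) \<le> ereal ?b"
            unfolding smallest_tree_eq[OF B]
            by (rule mixing_time_small_noise[OF assms A n n8 L F B \<epsilon> e(2)])
        qed (rule e(1))
      qed
    qed
    then have "measure ?N {e \<in> space ?N. small_noise n L e} \<le> measure (data_law n f0) ?E"
      unfolding law[OF E] .
    moreover have "1 - 4 / real n \<le> 1 - 1 / real n" by (simp add: divide_right_mono)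
    ultimately show ?thesis using small_noise_prob(1)[OF n L] by linarith
  qed
qed

end
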